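(* Let $R:(\mathcal C\times\mathcal C)^{op}\to\mathbf{Pos}$ be an extensional relational doctrine with quotients and let $F:S\to R$ be a fully faithful 1-arrow in $\mathbf{RD}$. Then the following are equivalent: (1) the 1-arrow $F^\sharp:S^{eq}\to R$ is an equivalence in $\mathbf{EQRD}$; (2) $F$ factors through $\mathsf{Proj}^R$ (i.e. $\widehat FA$ is $R$-projective for every object $A$ in the base of $S$), and for every object $X$ in $\mathcal C$ there are an object $P_X$ in the base of $S$ and a quotient arrow $q_X:\widehat FP_X\to X$ in $\mathcal C$.
   Context: $\mathbf{Pos}$ is the category of posets and monotone maps. A relational doctrine consists of a category $\mathcal C$ (its base); a functor $R:(\mathcal C\times\mathcal C)^{op}\to\mathbf{Pos}$ (for $f:X\to A$, $g:Y\to B$ write $R_{f,g}:R(A,B)\to R(X,Y)$); elements $d_X\in R(X,X)$ with $d_X\le R_{f,f}(d_Y)$ for all $f:X\to Y$; monotone maps $;:R(X,Y)\times R(Y,Z)\to R(X,Z)$ with $R_{f,g}(\alpha);R_{g,h}(\beta)\le R_{f,h}(\alpha;\beta)$; monotone maps $(-)^\bot:R(X,Y)\to R(Y,X)$ with $(R_{f,g}(\alpha))^\bot\le R_{g,f}(\alpha^\bot)$; such that $;$ is associative with units $d$, $(\alpha;\beta)^\bot=\beta^\bot;\alpha^\bot$, $d_X^\bot=d_X$, $\alpha^{\bot\bot}=\alpha$. The graph of $f:X\to Y$ is $\Gamma_f=R_{f,\mathrm{id}_Y}(d_Y)\in R(X,Y)$. An $R$-equivalence relation on $X$ is $\rho\in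 R(X,X)$ with $d_X\le\rho$, $\rho^\bot\le\rho$, $\rho;\rho\le\rho$. A quotient arrow of $\rho$ is $q:X\to W$ with $\rho\le\Gamma_q;\Gamma_q^\bot$ such that for every $f:X\to Z$ with $\rho\le\Gamma_f;\Gamma_f^\bot$ there is a unique $h:W\to Z$ with $f=h\circ q$. It is effective if $\rho=\Gamma_q;\Gamma_q^\bot$, and descent if $d_W\le\Gamma_q^\bot;\Gamma_q$. $R$ has quotients if every $R$-equivalence relation admits an effective descent quotient arrow. "A quotient arrow" means a quotient arrow of some $R$-equivalence relation. $R$ is extensional if, for parallel $f,g:X\to Y$, $d_X\le R_{f,g}(d_Y)$ implies $f=g$. The 2-category $\mathbf{RD}$: objects are relational doctrines; a 1-arrow $F:R\to S$ (bases $\mathcal C,\mathcal D$) is a pair of a functor $\widehat F:\mathcal C\to\mathcal D$ and a natural transformation with components $\overline F_{X,Y}:R(X,Y)\to S(\widehat FX,\widehat FY)$ strictly preserving $d$, $;$ and $(-)^\bot$; a 2-arrow $\theta:F\Rightarrow G$ is a natural transformation $\theta:\widehat F\to\widehat G$ with $\overline F_{X,Y}(\alpha)\le S_{\theta_X,\theta_Y}(\overline G_{X,Y}(\alpha))$. $\mathbf{EQRD}$ is the sub-2-category (full on 2-arrows) of extensional relational doctrines with quotients and 1-arrows $F$ preserving quotient arrows: if $q$ is a quotient arrow of $\rho$ on $X$ then $\widehat Fq$ is a quotient arrow of $\overline F_{X,X}(\rho)$. A 1-arrow $F$ is fully faithful if $\widehat F$ is fully faithful and $\overline F$ is an isomorphism.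 For $R$ with quotients, an object $P$ of the base is $R$-projective if for every arrow $f:P\to Y$ and every quotient arrow $q:X\to Y$ there is an arrow $h:P\to X$ with $f=q\circ h$. $\mathsf{Proj}^R$ is the restriction of $R$ to the full subcategory of its base on the $R$-projective objects. The extensional quotient completion $S^{eq}$ of a relational doctrine $S$: the base has objects the pairs $(X,\rho)$ with $\rho$ an $S$-equivalence relation on $X$; arrows $(X,\rho)\to(Y,\sigma)$ are classes $[f]$ of arrows $f:X\to Y$ in the base of $S$ with $\rho\le S_{f,f}(\sigma)$, where $[f]=[g]$ iff $\rho\le S_{f,g}(\sigma)$; $S^{eq}((X,\rho),(Y,\sigma))=\{\alpha\in S(X,Y)\mid\rho^\bot;\alpha;\sigma\le\alpha\}$, $S^{eq}_{[f],[g]}=S_{f,g}$, composition and converse are those of $S$, $d_{(X,\rho)}=\rho$. This gives a left biadjoint to the forgetful 2-functor $\mathbf{EQRD}\to\mathbf{RD}$. For $F:S\to R$ in $\mathbf{RD}$ with $R$ in $\mathbf{EQRD}$, $F^\sharp:S^{eq}\to R$ is its transpose along this biadjunction; explicitly (up to isomorphism), choosing for each $(X,\rho)$ a quotient arrow $q_{(X,\rho)}:\widehat FX\to\widehat{F^\sharp}(X,\rho)$ of $\overline F_{X,X}(\rho)$ in $R$, $\widehat{F^\sharp}[f]$ is the unique arrow with $\widehat{F^\sharp}[f]\circ q_{(X,\rho)}=q_{(Y,\sigma)}\circ\widehat Ff$, and $\overline{F^\sharp}(\alpha)=\Gamma_{q_{(X,\rho)}}^\bot;\overline F_{X,Y}(\alpha);\Gamma_{q_{(Y,\sigma)}}$.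 *)

theory Defs
  imports Main
begin

section \<open>Relational doctrines\<close>

text \<open>
  Composition is written in the usual order: \<open>Comp C g f\<close> is "g after f". All functions are only
  constrained on the carriers. Since the fibres over different pairs of objects need not be
  disjoint, the operations on fibres carry the objects as arguments.
\<close>

record ('o, 'a) cat =
  Ob :: "'o set"
  Ar :: "'a set"
  Dom :: "'a \<Rightarrow> 'o"
  Cod :: "'a \<Rightarrow> 'o"
  Idn :: "'o \<Rightarrow> 'a"
  Comp :: "'a \<Rightarrow> 'a \<Rightarrow> 'a"

definition Hom :: "('o, 'a, 'z) cat_scheme \<Rightarrow> 'o \<Rightarrow> 'o \<Rightarrow> 'a set" where
  "Hom C X Y = {f \<in> Ar C. Dom C f = X \<and> Cod C f = Y}"

locale category =
  fixes C :: "('o, 'a, 'z) cat_scheme"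
  assumes Dom_in_Ob: "f \<in> Ar C \<Longrightarrow> Dom C f \<in> Ob C"
    and Cod_in_Ob: "f \<in> Ar C \<Longrightarrow> Cod C f \<in> Ob C"
    and Idn_in_Hom: "X \<in> Ob C \<Longrightarrow> Idn C X \<in> Hom C X X"
    and Comp_in_Hom: "f \<in> Hom C X Y \<Longrightarrow> g \<in> Hom C Y Z \<Longrightarrow> Comp C g f \<in> Hom C X Z"
    and Comp_Idn_left: "f \<in> Hom C X Y \<Longrightarrow> Comp C (Idn C Y) f = f"
    and Comp_Idn_right: "f \<in> Hom C X Y \<Longrightarrow> Comp C f (Idn C X) = f"
    and Comp_assoc: "f \<in> Hom C X Y \<Longrightarrow> g \<in> Hom C Y Z \<Longrightarrow> h \<in> Hom C Z W \<Longrightarrow>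
      Comp C h (Comp C g f) = Comp C (Comp C h g) f"

text \<open>
  \<open>fib R X Y\<close> is the underlying set of the poset R(X,Y), with order \<open>le R X Y\<close>; \<open>re R f g\<close> is
  the reindexing map along (f,g); \<open>rc R X Y Z\<close> is relational composition
  R(X,Y) x R(Y,Z) -> R(X,Z) in diagrammatic order; \<open>cv R X Y\<close> is the converse; \<open>dg R X\<close> is the
  identity relation.
\<close>

record ('o, 'a, 'r) doctrine = "('o, 'a) cat" +
  fib :: "'o \<Rightarrow> 'o \<Rightarrow> 'r set"
  le :: "'o \<Rightarrow> 'o \<Rightarrow> 'r \<Rightarrow> 'r \<Rightarrow> bool"
  re :: "'a \<Rightarrow> 'a \<Rightarrow> 'r \<Rightarrow> 'r"
  rc :: "'o \<Rightarrow> 'o \<Rightarrow> 'o \<Rightarrow> 'r \<Rightarrow> 'r \<Rightarrow> 'r"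
  cv :: "'o \<Rightarrow> 'o \<Rightarrow> 'r \<Rightarrow> 'r"
  dg :: "'o \<Rightarrow> 'r"

locale relational_doctrine = category R for R :: "('o, 'a, 'r) doctrine" +
  assumes le_refl: "X \<in> Ob R \<Longrightarrow> Y \<in> Ob R \<Longrightarrow> reflp_on (fib R X Y) (le R X Y)"
    and le_antisym: "X \<in> Ob R \<Longrightarrow> Y \<in> Ob R \<Longrightarrow> antisymp_on (fib R X Y) (le R X Y)"
    and le_trans: "X \<in> Ob R \<Longrightarrow> Y \<in> Ob R \<Longrightarrow> transp_on (fib R X Y) (le R X Y)"
    \<comment> \<open>R is a contravariant functor to posets\<close>
    and re_closed: "f \<in> Hom R X A \<Longrightarrow> g \<in> Hom R Y B \<Longrightarrow> \<alpha> \<in> fib R A B \<Longrightarrow>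
      re R f g \<alpha> \<in> fib R X Y"
    and re_mono: "f \<in> Hom R X A \<Longrightarrow> g \<in> Hom R Y B \<Longrightarrow>
      monotone_on (fib R A B) (le R A B) (le R X Y) (re R f g)"
    and re_Idn: "X \<in> Ob R \<Longrightarrow> Y \<in> Ob R \<Longrightarrow> \<alpha> \<in> fib R X Y \<Longrightarrow>
      re R (Idn R X) (Idn R Y) \<alpha> = \<alpha>"
    and re_Comp: "f' \<in> Hom R X' X \<Longrightarrow> f \<in> Hom R X A \<Longrightarrow> g' \<in> Hom R Y' Y \<Longrightarrow> g \<in> Hom R Y B \<Longrightarrow>
      \<alpha> \<in> fib R A B \<Longrightarrow> re R (Comp R f f') (Comp R g g') \<alpha> = re R f' g' (re R f g \<alpha>)"
    \<comment> \<open>identity relations\<close>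
    and dg_closed: "X \<in> Ob R \<Longrightarrow> dg R X \<in> fib R X X"
    and dg_lax: "f \<in> Hom R X Y \<Longrightarrow> le R X X (dg R X) (re R f f (dg R Y))"
    \<comment> \<open>relational composition\<close>
    and rc_closed: "X \<in> Ob R \<Longrightarrow> Y \<in> Ob R \<Longrightarrow> Z \<in> Ob R \<Longrightarrow>
      \<alpha> \<in> fib R X Y \<Longrightarrow> \<beta> \<in> fib R Y Z \<Longrightarrow> rc R X Y Z \<alpha> \<beta> \<in> fib R X Z"
    and rc_mono: "X \<in> Ob R \<Longrightarrow> Y \<in> Ob R \<Longrightarrow> Z \<in> Ob R \<Longrightarrow>
      \<alpha> \<in> fib R X Y \<Longrightarrow> \<alpha>' \<in> fib R X Y \<Longrightarrow> \<beta> \<in> fib R Y Z \<Longrightarrow> \<beta>' \<in> fib R Y Z \<Longrightarrow>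
      le R X Y \<alpha> \<alpha>' \<Longrightarrow> le R Y Z \<beta> \<beta>' \<Longrightarrow> le R X Z (rc R X Y Z \<alpha> \<beta>) (rc R X Y Z \<alpha>' \<beta>')"
    and rc_lax: "f \<in> Hom R X A \<Longrightarrow> g \<in> Hom R Y B \<Longrightarrow> h \<in> Hom R Z E \<Longrightarrow>
      \<alpha> \<in> fib R A B \<Longrightarrow> \<beta> \<in> fib R B E \<Longrightarrow>
      le R X Z (rc R X Y Z (re R f g \<alpha>) (re R g h \<beta>)) (re R f h (rc R A B E \<alpha> \<beta>))"
    and rc_assoc: "X \<in> Ob R \<Longrightarrow> Y \<in> Ob R \<Longrightarrow> Z \<in> Ob R \<Longrightarrow> W \<in> Ob R \<Longrightarrow>
      \<alpha> \<in> fib R X Y \<Longrightarrow> \<beta> \<in> fib R Y Z \<Longrightarrow> \<gamma> \<in> fib R Z W \<Longrightarrow>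
      rc R X Z W (rc R X Y Z \<alpha> \<beta>) \<gamma> = rc R X Y W \<alpha> (rc R Y Z W \<beta> \<gamma>)"
    and rc_dg_left: "X \<in> Ob R \<Longrightarrow> Y \<in> Ob R \<Longrightarrow> \<alpha> \<in> fib R X Y \<Longrightarrow> rc R X X Y (dg R X) \<alpha> = \<alpha>"
    and rc_dg_right: "X \<in> Ob R \<Longrightarrow> Y \<in> Ob R \<Longrightarrow> \<alpha> \<in> fib R X Y \<Longrightarrow> rc R X Y Y \<alpha> (dg R Y) = \<alpha>"
    \<comment> \<open>converse\<close>
    and cv_closed: "X \<in> Ob R \<Longrightarrow> Y \<in> Ob R \<Longrightarrow> \<alpha> \<in> fib R X Y \<Longrightarrow> cv R X Y \<alpha> \<in> fib R Y X"
    and cv_mono: "X \<in> Ob R \<Longrightarrow> Y \<in> Ob R \<Longrightarrow>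
      monotone_on (fib R X Y) (le R X Y) (le R Y X) (cv R X Y)"
    and cv_lax: "f \<in> Hom R X A \<Longrightarrow> g \<in> Hom R Y B \<Longrightarrow> \<alpha> \<in> fib R A B \<Longrightarrow>
      le R Y X (cv R X Y (re R f g \<alpha>)) (re R g f (cv R A B \<alpha>))"
    and cv_rc: "X \<in> Ob R \<Longrightarrow> Y \<in> Ob R \<Longrightarrow> Z \<in> Ob R \<Longrightarrow> \<alpha> \<in> fib R X Y \<Longrightarrow> \<beta> \<in> fib R Y Z \<Longrightarrow>
      cv R X Z (rc R X Y Z \<alpha> \<beta>) = rc R Z Y X (cv R Y Z \<beta>) (cv R X Y \<alpha>)"
    and cv_dg: "X \<in> Ob R \<Longrightarrow> cv R X X (dg R X) = dg R X"
    and cv_cv: "X \<in> Ob R \<Longrightarrow> Y \<in> Ob R \<Longrightarrow> \<alpha> \<in> fib R X Y \<Longrightarrow> cv R Y X (cv R X Y \<alpha>) = \<alpha>"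

definition graph :: "('o, 'a, 'r) doctrine \<Rightarrow> 'a \<Rightarrow> 'r" where
  "graph R f = re R f (Idn R (Cod R f)) (dg R (Cod R f))"

definition cograph :: "('o, 'a, 'r) doctrine \<Rightarrow> 'a \<Rightarrow> 'r" where
  "cograph R f = cv R (Dom R f) (Cod R f) (graph R f)"

definition extensional :: "('o, 'a, 'r) doctrine \<Rightarrow> bool" where
  "extensional R \<longleftrightarrow> (\<forall>X\<in>Ob R. \<forall>Y\<in>Ob R. \<forall>f\<in>Hom R X Y. \<forall>g\<in>Hom R X Y.
     le R X X (dg R X) (re R f g (dg R Y)) \<longrightarrow> f = g)"


section \<open>Equivalence relations and quotients\<close>

definition eqrel :: "('o, 'a, 'r) doctrine \<Rightarrow> 'o \<Rightarrow> 'r \<Rightarrow> bool" where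
  "eqrel R X \<rho> \<longleftrightarrow> X \<in> Ob R \<and> \<rho> \<in> fib R X X \<and> le R X X (dg R X) \<rho> \<and>
     le R X X (cv R X X \<rho>) \<rho> \<and> le R X X (rc R X X X \<rho> \<rho>) \<rho>"

definition kernel :: "('o, 'a, 'r) doctrine \<Rightarrow> 'a \<Rightarrow> 'r" where
  "kernel R f = rc R (Dom R f) (Cod R f) (Dom R f) (graph R f) (cograph R f)"

definition quotient_arrow :: "('o, 'a, 'r) doctrine \<Rightarrow> 'o \<Rightarrow> 'r \<Rightarrow> 'a \<Rightarrow> 'o \<Rightarrow> bool" where
  "quotient_arrow R X \<rho> q W \<longleftrightarrow> eqrel R X \<rho> \<and> q \<in> Hom R X W \<and> le R X X \<rho> (kernel R q) \<and>
     (\<forall>Z\<in>Ob R. \<forall>f\<in>Hom R X Z. le R X X \<rho> (kernel R f) \<longrightarrow>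
        (\<exists>!h. h \<in> Hom R W Z \<and> f = Comp R h q))"

definition is_quotient_arrow :: "('o, 'a, 'r) doctrine \<Rightarrow> 'o \<Rightarrow> 'a \<Rightarrow> 'o \<Rightarrow> bool" where
  "is_quotient_arrow R X q W \<longleftrightarrow> (\<exists>\<rho>. quotient_arrow R X \<rho> q W)"

definition effective :: "('o, 'a, 'r) doctrine \<Rightarrow> 'r \<Rightarrow> 'a \<Rightarrow> bool" where
  "effective R \<rho> q \<longleftrightarrow> \<rho> = kernel R q"

definition descent :: "('o, 'a, 'r) doctrine \<Rightarrow> 'a \<Rightarrow> bool" where
  "descent R q \<longleftrightarrow> le R (Cod R q) (Cod R q) (dg R (Cod R q))
     (rc R (Cod R q) (Dom R q) (Cod R q) (cograph R q) (graph R q))"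

definition has_quotients :: "('o, 'a, 'r) doctrine \<Rightarrow> bool" where
  "has_quotients R \<longleftrightarrow> (\<forall>X \<rho>. eqrel R X \<rho> \<longrightarrow>
     (\<exists>q W. quotient_arrow R X \<rho> q W \<and> effective R \<rho> q \<and> descent R q))"


section \<open>The 2-categories RD and EQRD\<close>

record ('o, 'a, 'r, 'p, 'b, 's) rd_map =
  FOb :: "'o \<Rightarrow> 'p"
  FAr :: "'a \<Rightarrow> 'b"
  FFib :: "'o \<Rightarrow> 'o \<Rightarrow> 'r \<Rightarrow> 's"

locale rd_arrow =
  dom: relational_doctrine R + cod: relational_doctrine S
  for R :: "('o, 'a, 'r) doctrine" and S :: "('p, 'b, 's) doctrine" +
  fixes F :: "('o, 'a, 'r, 'p, 'b, 's) rd_map"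
  assumes FOb_closed: "X \<in> Ob R \<Longrightarrow> FOb F X \<in> Ob S"
    and FAr_closed: "f \<in> Hom R X Y \<Longrightarrow> FAr F f \<in> Hom S (FOb F X) (FOb F Y)"
    and FAr_Idn: "X \<in> Ob R \<Longrightarrow> FAr F (Idn R X) = Idn S (FOb F X)"
    and FAr_Comp: "f \<in> Hom R X Y \<Longrightarrow> g \<in> Hom R Y Z \<Longrightarrow>
      FAr F (Comp R g f) = Comp S (FAr F g) (FAr F f)"
    and FFib_closed: "X \<in> Ob R \<Longrightarrow> Y \<in> Ob R \<Longrightarrow> \<alpha> \<in> fib R X Y \<Longrightarrow>
      FFib F X Y \<alpha> \<in> fib S (FOb F X) (FOb F Y)"
    and FFib_mono: "X \<in> Ob R \<Longrightarrow> Y \<in> Ob R \<Longrightarrow>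
      monotone_on (fib R X Y) (le R X Y) (le S (FOb F X) (FOb F Y)) (FFib F X Y)"
    and FFib_natural: "f \<in> Hom R X A \<Longrightarrow> g \<in> Hom R Y B \<Longrightarrow> \<alpha> \<in> fib R A B \<Longrightarrow>
      FFib F X Y (re R f g \<alpha>) = re S (FAr F f) (FAr F g) (FFib F A B \<alpha>)"
    and FFib_dg: "X \<in> Ob R \<Longrightarrow> FFib F X X (dg R X) = dg S (FOb F X)"
    and FFib_rc: "X \<in> Ob R \<Longrightarrow> Y \<in> Ob R \<Longrightarrow> Z \<in> Ob R \<Longrightarrow> \<alpha> \<in> fib R X Y \<Longrightarrow> \<beta> \<in> fib R Y Z \<Longrightarrow>
      FFib F X Z (rc R X Y Z \<alpha> \<beta>) =
        rc S (FOb F X) (FOb F Y) (FOb F Z) (FFib F X Y \<alpha>) (FFib F Y Z \<beta>)"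
    and FFib_cv: "X \<in> Ob R \<Longrightarrow> Y \<in> Ob R \<Longrightarrow> \<alpha> \<in> fib R X Y \<Longrightarrow>
      FFib F Y X (cv R X Y \<alpha>) = cv S (FOb F X) (FOb F Y) (FFib F X Y \<alpha>)"

definition rd_id :: "('o, 'a, 'r, 'o, 'a, 'r) rd_map" where
  "rd_id = \<lparr>FOb = (\<lambda>X. X), FAr = (\<lambda>f. f), FFib = (\<lambda>X Y \<alpha>. \<alpha>)\<rparr>"

definition rd_comp :: "('p, 'b, 's, 'q, 'c, 't) rd_map \<Rightarrow> ('o, 'a, 'r, 'p, 'b, 's) rd_map \<Rightarrow>
    ('o, 'a, 'r, 'q, 'c, 't) rd_map" where
  "rd_comp G F = \<lparr>FOb = (\<lambda>X. FOb G (FOb F X)), FAr = (\<lambda>f. FAr G (FAr F f)),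
     FFib = (\<lambda>X Y \<alpha>. FFib G (FOb F X) (FOb F Y) (FFib F X Y \<alpha>))\<rparr>"

text \<open>Equality of 1-arrows with source R, i.e. agreement on the carriers.\<close>

definition rd_eq :: "('o, 'a, 'r) doctrine \<Rightarrow>
    ('o, 'a, 'r, 'p, 'b, 's) rd_map \<Rightarrow> ('o, 'a, 'r, 'p, 'b, 's) rd_map \<Rightarrow> bool" where
  "rd_eq R F G \<longleftrightarrow> (\<forall>X\<in>Ob R. FOb F X = FOb G X) \<and> (\<forall>f\<in>Ar R. FAr F f = FAr G f) \<and>
     (\<forall>X\<in>Ob R. \<forall>Y\<in>Ob R. \<forall>\<alpha>\<in>fib R X Y. FFib F X Y \<alpha> = FFib G X Y \<alpha>)"

definition fully_faithful :: "('o, 'a, 'r) doctrine \<Rightarrow> ('p, 'b, 's) doctrine \<Rightarrow>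
    ('o, 'a, 'r, 'p, 'b, 's) rd_map \<Rightarrow> bool" where
  "fully_faithful R S F \<longleftrightarrow>
     (\<forall>X\<in>Ob R. \<forall>Y\<in>Ob R. bij_betw (FAr F) (Hom R X Y) (Hom S (FOb F X) (FOb F Y))) \<and>
     (\<forall>X\<in>Ob R. \<forall>Y\<in>Ob R.
        bij_betw (FFib F X Y) (fib R X Y) (fib S (FOb F X) (FOb F Y)) \<and>
        (\<forall>\<alpha>\<in>fib R X Y. \<forall>\<beta>\<in>fib R X Y.
           le R X Y \<alpha> \<beta> \<longleftrightarrow> le S (FOb F X) (FOb F Y) (FFib F X Y \<alpha>) (FFib F X Y \<beta>)))"

definition two_arrow :: "('o, 'a, 'r) doctrine \<Rightarrow> ('p, 'b, 's) doctrine \<Rightarrow>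
    ('o, 'a, 'r, 'p, 'b, 's) rd_map \<Rightarrow> ('o, 'a, 'r, 'p, 'b, 's) rd_map \<Rightarrow> ('o \<Rightarrow> 'b) \<Rightarrow> bool" where
  "two_arrow R S F G \<theta> \<longleftrightarrow>
     (\<forall>X\<in>Ob R. \<theta> X \<in> Hom S (FOb F X) (FOb G X)) \<and>
     (\<forall>X\<in>Ob R. \<forall>Y\<in>Ob R. \<forall>f\<in>Hom R X Y. Comp S (\<theta> Y) (FAr F f) = Comp S (FAr G f) (\<theta> X)) \<and>
     (\<forall>X\<in>Ob R. \<forall>Y\<in>Ob R. \<forall>\<alpha>\<in>fib R X Y.
        le S (FOb F X) (FOb F Y) (FFib F X Y \<alpha>) (re S (\<theta> X) (\<theta> Y) (FFib G X Y \<alpha>)))"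

definition iso_one_arrows :: "('o, 'a, 'r) doctrine \<Rightarrow> ('p, 'b, 's) doctrine \<Rightarrow>
    ('o, 'a, 'r, 'p, 'b, 's) rd_map \<Rightarrow> ('o, 'a, 'r, 'p, 'b, 's) rd_map \<Rightarrow> bool" where
  "iso_one_arrows R S F G \<longleftrightarrow> (\<exists>\<theta> \<theta>'. two_arrow R S F G \<theta> \<and> two_arrow R S G F \<theta>' \<and>
     (\<forall>X\<in>Ob R. Comp S (\<theta>' X) (\<theta> X) = Idn S (FOb F X) \<and> Comp S (\<theta> X) (\<theta>' X) = Idn S (FOb G X)))"

definition eqrd_object :: "('o, 'a, 'r) doctrine \<Rightarrow> bool" where
  "eqrd_object R \<longleftrightarrow> relational_doctrine R \<and> extensional R \<and> has_quotients R"

definition preserves_quotient_arrows :: "('o, 'a, 'r) doctrine \<Rightarrow> ('p, 'b, 's) doctrine \<Rightarrow>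
    ('o, 'a, 'r, 'p, 'b, 's) rd_map \<Rightarrow> bool" where
  "preserves_quotient_arrows R S F \<longleftrightarrow> (\<forall>X \<rho> q W. quotient_arrow R X \<rho> q W \<longrightarrow>
     quotient_arrow S (FOb F X) (FFib F X X \<rho>) (FAr F q) (FOb F W))"

definition eqrd_arrow :: "('o, 'a, 'r) doctrine \<Rightarrow> ('p, 'b, 's) doctrine \<Rightarrow>
    ('o, 'a, 'r, 'p, 'b, 's) rd_map \<Rightarrow> bool" where
  "eqrd_arrow R S F \<longleftrightarrow> eqrd_object R \<and> eqrd_object S \<and> rd_arrow R S F \<and>
     preserves_quotient_arrows R S F"

definition eqrd_equivalence :: "('o, 'a, 'r) doctrine \<Rightarrow> ('p, 'b, 's) doctrine \<Rightarrow>
    ('o, 'a, 'r, 'p, 'b, 's) rd_map \<Rightarrow> bool" where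
  "eqrd_equivalence R S F \<longleftrightarrow> eqrd_arrow R S F \<and>
     (\<exists>G. eqrd_arrow S R G \<and>
        iso_one_arrows R R rd_id (rd_comp G F) \<and> iso_one_arrows S S (rd_comp F G) rd_id)"


section \<open>Projective objects\<close>

definition projective :: "('o, 'a, 'r) doctrine \<Rightarrow> 'o \<Rightarrow> bool" where
  "projective R P \<longleftrightarrow> P \<in> Ob R \<and> (\<forall>X Y. \<forall>q. is_quotient_arrow R X q Y \<longrightarrow>
     (\<forall>f\<in>Hom R P Y. \<exists>h\<in>Hom R P X. f = Comp R q h))"

definition Proj :: "('o, 'a, 'r) doctrine \<Rightarrow> ('o, 'a, 'r) doctrine" where
  "Proj R = R\<lparr>Ob := {P. projective R P},
     Ar := {f \<in> Ar R. projective R (Dom R f) \<and> projective R (Cod R f)}\<rparr>"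

text \<open>The inclusion of \<open>Proj R\<close> into \<open>R\<close> is the identity on underlying data, i.e. \<open>rd_id\<close>.\<close>

definition factors_through_Proj :: "('o, 'a, 'r) doctrine \<Rightarrow> ('p, 'b, 's) doctrine \<Rightarrow>
    ('o, 'a, 'r, 'p, 'b, 's) rd_map \<Rightarrow> bool" where
  "factors_through_Proj S R F \<longleftrightarrow> (\<exists>G. rd_arrow S (Proj R) G \<and> rd_eq S F (rd_comp rd_id G))"


section \<open>The extensional quotient completion\<close>

definition arr_eq :: "('o, 'a, 'r) doctrine \<Rightarrow> 'o \<times> 'r \<Rightarrow> 'o \<times> 'r \<Rightarrow> ('a \<times> 'a) set" where
  "arr_eq S = (\<lambda>(X, \<rho>) (Y, \<sigma>). {(f, g).
     f \<in> Hom S X Y \<and> le S X X \<rho> (re S f f \<sigma>) \<and>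
     g \<in> Hom S X Y \<and> le S X X \<rho> (re S g g \<sigma>) \<and>
     le S X X \<rho> (re S f g \<sigma>)})"

definition eq_hom :: "('o, 'a, 'r) doctrine \<Rightarrow> 'o \<times> 'r \<Rightarrow> 'o \<times> 'r \<Rightarrow> 'a set set" where
  "eq_hom S = (\<lambda>(X, \<rho>) (Y, \<sigma>).
     {f \<in> Hom S X Y. le S X X \<rho> (re S f f \<sigma>)} // arr_eq S (X, \<rho>) (Y, \<sigma>))"

text \<open>
  An arrow of the completion is a triple of source, class of arrows, target. Operations on
  classes are computed on an arbitrary representative.
\<close>

type_synonym ('o, 'a, 'r) eq_arr = "('o \<times> 'r) \<times> 'a set \<times> ('o \<times> 'r)"

fun eq_src :: "('o, 'a, 'r) eq_arr \<Rightarrow> 'o \<times> 'r" where "eq_src (A, c, B) = A"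
fun eq_tgt :: "('o, 'a, 'r) eq_arr \<Rightarrow> 'o \<times> 'r" where "eq_tgt (A, c, B) = B"
fun eq_rep :: "('o, 'a, 'r) eq_arr \<Rightarrow> 'a" where "eq_rep (A, c, B) = (SOME f. f \<in> c)"

definition eq_class :: "('o, 'a, 'r) doctrine \<Rightarrow> 'o \<times> 'r \<Rightarrow> 'a \<Rightarrow> 'o \<times> 'r \<Rightarrow> ('o, 'a, 'r) eq_arr" where
  "eq_class S A f B = (A, arr_eq S A B `` {f}, B)"

definition eq_completion :: "('o, 'a, 'r) doctrine \<Rightarrow> ('o \<times> 'r, ('o, 'a, 'r) eq_arr, 'r) doctrine" where
  "eq_completion S = \<lparr>
     Ob = {(X, \<rho>). eqrel S X \<rho>},
     Ar = {(A, c, B). (case A of (X, \<rho>) \<Rightarrow> eqrel S X \<rho>) \<and> (case B of (Y, \<sigma>) \<Rightarrow> eqrel S Y \<sigma>) \<and>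
             c \<in> eq_hom S A B},
     Dom = eq_src,
     Cod = eq_tgt,
     Idn = (\<lambda>A. eq_class S A (Idn S (fst A)) A),
     Comp = (\<lambda>v u. eq_class S (eq_src u) (Comp S (eq_rep v) (eq_rep u)) (eq_tgt v)),
     fib = (\<lambda>(X, \<rho>) (Y, \<sigma>).
             {\<alpha> \<in> fib S X Y. le S X Y (rc S X Y Y (rc S X X Y (cv S X X \<rho>) \<alpha>) \<sigma>) \<alpha>}),
     le = (\<lambda>A B. le S (fst A) (fst B)),
     re = (\<lambda>u v. re S (eq_rep u) (eq_rep v)),
     rc = (\<lambda>A B E. rc S (fst A) (fst B) (fst E)),
     cv = (\<lambda>A B. cv S (fst A) (fst B)),
     dg = snd\<rparr>"

text \<open>
  The transpose depends on a choice \<open>q\<close> of quotient arrows in \<open>R\<close> of the images under \<open>F\<close> of the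
  equivalence relations of \<open>S\<close>; any two choices give isomorphic transposes.
\<close>

definition quotient_choice :: "('o, 'a, 'r) doctrine \<Rightarrow> ('p, 'b, 's) doctrine \<Rightarrow>
    ('o, 'a, 'r, 'p, 'b, 's) rd_map \<Rightarrow> ('o \<times> 'r \<Rightarrow> 'b) \<Rightarrow> bool" where
  "quotient_choice S R F q \<longleftrightarrow> (\<forall>X \<rho>. eqrel S X \<rho> \<longrightarrow>
     quotient_arrow R (FOb F X) (FFib F X X \<rho>) (q (X, \<rho>)) (Cod R (q (X, \<rho>))))"

definition eq_transpose :: "('p, 'b, 's) doctrine \<Rightarrow>
    ('o, 'a, 'r, 'p, 'b, 's) rd_map \<Rightarrow> ('o \<times> 'r \<Rightarrow> 'b) \<Rightarrow>
    ('o \<times> 'r, ('o, 'a, 'r) eq_arr, 'r, 'p, 'b, 's) rd_map" where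
  "eq_transpose R F q = \<lparr>
     FOb = (\<lambda>A. Cod R (q A)),
     FAr = (\<lambda>u. THE h. h \<in> Hom R (Cod R (q (eq_src u))) (Cod R (q (eq_tgt u))) \<and>
              Comp R h (q (eq_src u)) = Comp R (q (eq_tgt u)) (FAr F (eq_rep u))),
     FFib = (\<lambda>A B \<alpha>.
              rc R (Cod R (q A)) (FOb F (fst B)) (Cod R (q B))
                (rc R (Cod R (q A)) (FOb F (fst A)) (FOb F (fst B))
                  (cograph R (q A)) (FFib F (fst A) (fst B) \<alpha>))
                (graph R (q B)))\<rparr>"

end

theory Submission
  imports Defs
begin

text \<open>
  Write \<open>T\<close> for the completion of \<open>S\<close>, \<open>K\<close> for the transpose of \<open>F\<close>, and \<open>q A : F X \<rightarrow> K A\<close> for the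
  chosen quotient arrow at \<open>A = (X, \<rho>)\<close>. Two facts make \<open>K\<close> tractable. First, in every relational
  doctrine reindexing along \<open>(f, g)\<close> is composition with the graph of \<open>f\<close> and the converse of the
  graph of \<open>g\<close> (\<open>re_via_graphs\<close>), so reindexing along descent arrows is injective, reflects the
  order and commutes with relational composition. Secondly, a quotient arrow of \<open>\<rho>\<close> is unique up to
  isomorphism, so in a doctrine with quotients every quotient arrow of \<open>\<rho>\<close> is effective and descent
  (\<open>quotient_effective_descent\<close>). Hence \<open>K u\<close> is the only arrow with \<open>K u \<circ> q A = q B \<circ> F f\<close> for a
  representative \<open>f\<close> of \<open>u\<close>, and \<open>K \<alpha>\<close> is the only relation whose reindexing along \<open>(q A, q B)\<close>
  is \<open>F \<alpha>\<close>. Since \<open>F\<close> is an order isomorphism on fibres, these two descriptions make \<open>K\<close>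
  injective on arrows, an order isomorphism on fibres, and compatible with all operations. The laws of a relational doctrine therefore hold in \<open>T\<close>
  because they hold in \<open>R\<close> (\<open>transported_doctrine\<close>).

  From projective covers to the equivalence: an arrow \<open>K A \<rightarrow> K B\<close> precomposed with \<open>q A\<close> lifts along
  \<open>q B\<close> because the values of \<open>F\<close> are projective, and the lift is in the image of \<open>F\<close>; so \<open>K\<close> is full.
  A quotient arrow \<open>F P \<rightarrow> X\<close> is a quotient arrow of some \<open>F \<rho>\<close>, so \<open>X\<close> is isomorphic to \<open>K (P, \<rho>)\<close>;
  so \<open>K\<close> is essentially surjective. A fully faithful and essentially surjective 1-arrow preserves and
  reflects quotient arrows, which yields extensionality and quotients in \<open>T\<close> and a pseudo-inverse
  that is again a 1-arrow of the right kind (\<open>equivalence\<close>).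

  From the equivalence to projective covers: every \<open>X\<close> is isomorphic to some \<open>K A\<close>, and \<open>q A\<close> followed
  by the isomorphism is the cover. For the projectivity of \<open>F P\<close>, let \<open>p : X \<rightarrow> Y\<close> be a quotient arrow,
  \<open>f : F P \<rightarrow> Y\<close>, and \<open>c : F B \<rightarrow> X\<close> a cover. The composite \<open>p \<circ> c\<close> is a quotient arrow, and its kernel
  is \<open>F \<sigma>\<close> for some \<open>\<sigma>\<close> because \<open>F\<close> is full on fibres; so \<open>Y\<close> is isomorphic to \<open>K (B, \<sigma>)\<close>. Also \<open>F P\<close>
  is isomorphic to \<open>K (P, d)\<close>. Fullness of \<open>K\<close> thus presents \<open>f\<close> as an arrow of \<open>T\<close>, and a
  representative \<open>k\<close> of that arrow satisfies \<open>f = p \<circ> c \<circ> F k\<close> (\<open>projective_if_equivalence\<close>).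
\<close>

section \<open>Mutually inverse arrows\<close>

definition inverse_pair :: "('o, 'a, 'z) cat_scheme \<Rightarrow> 'a \<Rightarrow> 'a \<Rightarrow> 'o \<Rightarrow> 'o \<Rightarrow> bool" where
  "inverse_pair C e e' X Y \<longleftrightarrow> e \<in> Hom C X Y \<and> e' \<in> Hom C Y X \<and>
     Comp C e' e = Idn C X \<and> Comp C e e' = Idn C Y"

context category
begin

lemma Hom_Ob: "f \<in> Hom C X Y \<Longrightarrow> X \<in> Ob C" "f \<in> Hom C X Y \<Longrightarrow> Y \<in> Ob C"
  using Dom_in_Ob Cod_in_Ob by (auto simp: Hom_def)

lemma Hom_Dom_Cod: "f \<in> Hom C X Y \<Longrightarrow> Dom C f = X" "f \<in> Hom C X Y \<Longrightarrow> Cod C f = Y"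
  by (auto simp: Hom_def)

lemma inverse_pairD:
  assumes "inverse_pair C e e' X Y"
  shows "e \<in> Hom C X Y" "e' \<in> Hom C Y X" "Comp C e' e = Idn C X" "Comp C e e' = Idn C Y"
    "X \<in> Ob C" "Y \<in> Ob C"
  using assms Hom_Ob by (auto simp: inverse_pair_def)

lemma inverse_pair_sym: "inverse_pair C e e' X Y \<Longrightarrow> inverse_pair C e' e Y X"
  by (auto simp: inverse_pair_def)

lemma cancel_inverse_left:
  assumes "inverse_pair C e e' X Y" "f \<in> Hom C Z X"
  shows "Comp C e' (Comp C e f) = f"
  using inverse_pairD[OF assms(1)] Comp_assoc[OF assms(2), of e Y e' X] Comp_Idn_left[OF assms(2)]
  by simp

lemma cancel_inverse_right:
  assumes "inverse_pair C e e' X Y" "f \<in> Hom C Y Z"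
  shows "Comp C (Comp C f e) e' = f"
  using inverse_pairD[OF assms(1)] Comp_assoc[OF _ _ assms(2), of e' Y X e]
    Comp_Idn_right[OF assms(2)] by simp

end

section \<open>Reindexing as composition with graphs\<close>

context relational_doctrine
begin

lemma le_reflI: "X \<in> Ob R \<Longrightarrow> Y \<in> Ob R \<Longrightarrow> \<alpha> \<in> fib R X Y \<Longrightarrow> le R X Y \<alpha> \<alpha>"
  using le_refl by (auto dest: reflp_onD)

lemma le_antisymI: "le R X Y \<alpha> \<beta> \<Longrightarrow> le R X Y \<beta> \<alpha> \<Longrightarrow> X \<in> Ob R \<Longrightarrow> Y \<in> Ob R \<Longrightarrow>
    \<alpha> \<in> fib R X Y \<Longrightarrow> \<beta> \<in> fib R X Y \<Longrightarrow> \<alpha> = \<beta>"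
  using le_antisym by (auto dest: antisymp_onD)

lemma le_transI: "le R X Y \<alpha> \<beta> \<Longrightarrow> le R X Y \<beta> \<gamma> \<Longrightarrow> X \<in> Ob R \<Longrightarrow> Y \<in> Ob R \<Longrightarrow>
    \<alpha> \<in> fib R X Y \<Longrightarrow> \<beta> \<in> fib R X Y \<Longrightarrow> \<gamma> \<in> fib R X Y \<Longrightarrow> le R X Y \<alpha> \<gamma>"
  using le_trans by (auto dest: transp_onD)

lemma re_monoI: "le R A B \<alpha> \<beta> \<Longrightarrow> f \<in> Hom R X A \<Longrightarrow> g \<in> Hom R Y B \<Longrightarrow>
    \<alpha> \<in> fib R A B \<Longrightarrow> \<beta> \<in> fib R A B \<Longrightarrow> le R X Y (re R f g \<alpha>) (re R f g \<beta>)"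
  by (rule monotone_onD[OF re_mono])

lemma cv_monoI: "le R X Y \<alpha> \<beta> \<Longrightarrow> X \<in> Ob R \<Longrightarrow> Y \<in> Ob R \<Longrightarrow>
    \<alpha> \<in> fib R X Y \<Longrightarrow> \<beta> \<in> fib R X Y \<Longrightarrow> le R Y X (cv R X Y \<alpha>) (cv R X Y \<beta>)"
  by (rule monotone_onD[OF cv_mono])

text \<open>
  The laxity law applied to the converse of \<open>\<alpha>\<close> gives the opposite inequality, because the
  converse is a monotone involution.
\<close>

lemma cv_re:
  assumes f: "f \<in> Hom R X A" and g: "g \<in> Hom R Y B" and a: "\<alpha> \<in> fib R A B"
  shows "cv R X Y (re R f g \<alpha>) = re R g f (cv R A B \<alpha>)"
proof -
  note ob = Hom_Ob[OF f] Hom_Ob[OF g]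
  note c = re_closed[OF f g a] cv_closed[OF ob(2,4) a]
  have 1: "le R X Y (cv R Y X (re R g f (cv R A B \<alpha>))) (re R f g \<alpha>)"
    using cv_lax[OF g f c(2)] cv_cv[OF ob(2,4) a] by simp
  have 2: "re R g f (cv R A B \<alpha>) \<in> fib R Y X" using re_closed[OF g f c(2)] .
  have "le R Y X (cv R X Y (cv R Y X (re R g f (cv R A B \<alpha>)))) (cv R X Y (re R f g \<alpha>))"
    using cv_monoI[OF 1] ob c 2 cv_closed by simp
  then have "le R Y X (re R g f (cv R A B \<alpha>)) (cv R X Y (re R f g \<alpha>))"
    using cv_cv[OF ob(3,1) 2] by simp
  then show ?thesis
    using cv_lax[OF f g a] ob c 2 cv_closed by (simp add: le_antisymI)
qed

lemma graph_Hom: "f \<in> Hom R X A \<Longrightarrow> graph R f = re R f (Idn R A) (dg R A)"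
  by (simp add: graph_def Hom_Dom_Cod)

lemma graph_closed: "f \<in> Hom R X A \<Longrightarrow> graph R f \<in> fib R X A"
  using Hom_Ob[of f X A] by (simp add: graph_Hom re_closed[of _ _ A _ A A] Idn_in_Hom dg_closed)

lemma cograph_Hom: "f \<in> Hom R X A \<Longrightarrow> cograph R f = cv R X A (graph R f)"
  by (simp add: cograph_def Hom_Dom_Cod)

lemma cograph_re: "f \<in> Hom R X A \<Longrightarrow> cograph R f = re R (Idn R A) f (dg R A)"
  using Hom_Ob[of f X A] cv_re[of f X A "Idn R A" A A "dg R A"]
  by (simp add: cograph_Hom graph_Hom Idn_in_Hom dg_closed cv_dg)

lemma cograph_closed: "f \<in> Hom R X A \<Longrightarrow> cograph R f \<in> fib R A X"
  using Hom_Ob[of f X A] by (simp add: cograph_Hom cv_closed graph_closed)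

text \<open>
  Composition is only laxly natural, but the reindexings in the law share a middle arrow that may be
  chosen. For \<open>\<le>\<close> the identity relation of \<open>X\<close> lies below the reindexing of the graph of \<open>f\<close> along
  \<open>(id, f)\<close>; composing with it on the left (and dually on the right) moves \<open>f\<close> and \<open>g\<close> into the middle,
  where laxity absorbs them. For \<open>\<ge>\<close> the graph is itself a reindexed identity relation and laxity
  applies with identities in the middle.
\<close>

lemma re_via_graphs:
  assumes f: "f \<in> Hom R X A" and g: "g \<in> Hom R Y B" and a: "\<alpha> \<in> fib R A B"
  shows "re R f g \<alpha> = rc R X B Y (rc R X A B (graph R f) \<alpha>) (cograph R g)"
proof (rule le_antisymI)
  note ob [simp] = Hom_Ob[OF f] Hom_Ob[OF g]
  note i [simp] = Idn_in_Hom[OF ob(1)] Idn_in_Hom[OF ob(2)] Idn_in_Hom[OF ob(3)] Idn_in_Hom[OF ob(4)]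
  note c [simp] = re_closed[OF f g a] graph_closed[OF f] cograph_closed[OF f]
    graph_closed[OF g] cograph_closed[OF g] a f g dg_closed
  note c' [simp] = rc_closed[OF ob(1,2,4) c(2) a]
  note c'' [simp] = rc_closed[OF ob(1,4,3) c' c(5)]
  \<comment> \<open>The identity relation lies below a reindexed graph whose second index is \<open>f\<close>, and dually for \<open>g\<close>.\<close>
  have df: "le R X X (dg R X) (re R (Idn R X) f (graph R f))"
    using dg_lax[OF f] re_Comp[of "Idn R X" X X f A f X A "Idn R A" A "dg R A"]
    by (simp add: graph_Hom[OF f] Comp_Idn_left[OF f] Comp_Idn_right[OF f])
  have dg: "le R Y Y (dg R Y) (re R g (Idn R Y) (cograph R g))"
    using dg_lax[OF g] re_Comp[of g Y B "Idn R B" B "Idn R Y" Y Y g B "dg R B"]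
    by (simp add: cograph_re[OF g] Comp_Idn_left[OF g] Comp_Idn_right[OF g])
  note m [simp] = re_closed[OF i(1) f c(2)] re_closed[OF g i(3) c(5)]
  have "le R X Y (rc R X X Y (dg R X) (re R f g \<alpha>))
      (rc R X X Y (re R (Idn R X) f (graph R f)) (re R f g \<alpha>))"
    by (rule rc_mono) (simp_all add: df le_reflI)
  then have 1: "le R X Y (re R f g \<alpha>) (rc R X X Y (re R (Idn R X) f (graph R f)) (re R f g \<alpha>))"
    by (simp add: rc_dg_left)
  \<comment> \<open>Laxity with \<open>f\<close> in the middle, and then, in step 5, with \<open>g\<close> in the middle.\<close>
  have 2: "le R X Y (rc R X X Y (re R (Idn R X) f (graph R f)) (re R f g \<alpha>))
      (re R (Idn R X) g (rc R X A B (graph R f) \<alpha>))"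
    by (rule rc_lax) simp_all
  note m' [simp] = rc_closed[OF ob(1,1,3) m(1) c(1)] re_closed[OF i(1) g c']
  have 3: "le R X Y (re R f g \<alpha>) (re R (Idn R X) g (rc R X A B (graph R f) \<alpha>))"
    by (rule le_transI[OF 1 2]) simp_all
  have "le R X Y (rc R X Y Y (re R f g \<alpha>) (dg R Y))
     (rc R X Y Y (re R (Idn R X) g (rc R X A B (graph R f) \<alpha>)) (re R g (Idn R Y) (cograph R g)))"
    by (rule rc_mono) (simp_all add: dg 3)
  then have 4: "le R X Y (re R f g \<alpha>)
     (rc R X Y Y (re R (Idn R X) g (rc R X A B (graph R f) \<alpha>)) (re R g (Idn R Y) (cograph R g)))"
    by (simp add: rc_dg_right)
  have 5: "le R X Y (rc R X Y Y (re R (Idn R X) g (rc R X A B (graph R f) \<alpha>))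
      (re R g (Idn R Y) (cograph R g)))
    (re R (Idn R X) (Idn R Y) (rc R X B Y (rc R X A B (graph R f) \<alpha>) (cograph R g)))"
    by (rule rc_lax) simp_all
  have "le R X Y (re R f g \<alpha>)
    (re R (Idn R X) (Idn R Y) (rc R X B Y (rc R X A B (graph R f) \<alpha>) (cograph R g)))"
    by (rule le_transI[OF 4 5]) (simp_all add: rc_closed re_closed[OF i(1) i(3)])
  then show "le R X Y (re R f g \<alpha>) (rc R X B Y (rc R X A B (graph R f) \<alpha>) (cograph R g))"
    by (simp add: re_Idn)
  have "le R X B (rc R X A B (re R f (Idn R A) (dg R A)) (re R (Idn R A) (Idn R B) \<alpha>))
      (re R f (Idn R B) (rc R A A B (dg R A) \<alpha>))"
    by (rule rc_lax) simp_all
  then have 6: "le R X B (rc R X A B (graph R f) \<alpha>) (re R f (Idn R B) \<alpha>)"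
    by (simp add: graph_Hom[OF f] re_Idn rc_dg_left)
  note m'' [simp] = re_closed[OF f i(4) a]
  have 7: "le R X Y (rc R X B Y (rc R X A B (graph R f) \<alpha>) (cograph R g))
     (rc R X B Y (re R f (Idn R B) \<alpha>) (cograph R g))"
    by (rule rc_mono) (simp_all add: 6 le_reflI)
  have 8: "le R X Y (rc R X B Y (re R f (Idn R B) \<alpha>) (cograph R g)) (re R f g (rc R A B B \<alpha> (dg R B)))"
    unfolding cograph_re[OF g] by (rule rc_lax) simp_all
  have 9: "le R X Y (rc R X B Y (re R f (Idn R B) \<alpha>) (cograph R g)) (re R f g \<alpha>)"
    using 8 by (simp add: rc_dg_right)
  show "le R X Y (rc R X B Y (rc R X A B (graph R f) \<alpha>) (cograph R g)) (re R f g \<alpha>)"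
    by (rule le_transI[OF 7 9]) (simp_all add: rc_closed)
qed (use Hom_Ob[OF f] Hom_Ob[OF g] a in \<open>simp_all add: re_closed[OF f g] rc_closed
  graph_closed[OF f] cograph_closed[OF g]\<close>)

lemma kernel_re: "f \<in> Hom R X A \<Longrightarrow> kernel R f = re R f f (dg R A)"
  using re_via_graphs[of f X A f X A "dg R A"] Hom_Ob[of f X A]
  by (simp add: kernel_def Hom_Dom_Cod dg_closed rc_dg_right graph_closed)

lemma kernel_closed: "f \<in> Hom R X A \<Longrightarrow> kernel R f \<in> fib R X X"
  using Hom_Ob[of f X A] re_closed[of f X A f X A "dg R A"] by (simp add: dg_closed kernel_re)

lemma kernel_Comp:
  assumes f: "f \<in> Hom R X A" and g: "g \<in> Hom R A B"
  shows "kernel R (Comp R g f) = re R f f (kernel R g)"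
  using re_Comp[OF f g f g dg_closed] Hom_Ob[OF g]
  by (simp add: kernel_re[OF g] kernel_re[OF Comp_in_Hom[OF f g]])

lemma kernel_Comp_mono:
  assumes f: "f \<in> Hom R X A" and g: "g \<in> Hom R A B"
  shows "le R X X (kernel R f) (kernel R (Comp R g f))"
  using re_monoI[OF dg_lax[OF g] f f] Hom_Ob[OF f] kernel_closed[OF g]
  by (simp add: kernel_Comp[OF f g] kernel_re[OF f] kernel_re[OF g] dg_closed)

lemma kernel_Idn: "X \<in> Ob R \<Longrightarrow> kernel R (Idn R X) = dg R X"
  by (simp add: kernel_re[OF Idn_in_Hom] re_Idn dg_closed)

lemma eqrel_kernel:
  assumes f: "f \<in> Hom R X A"
  shows "eqrel R X (kernel R f)"
proof -
  note ob = Hom_Ob[OF f]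
  have "le R X X (rc R X X X (re R f f (dg R A)) (re R f f (dg R A)))
     (re R f f (rc R A A A (dg R A) (dg R A)))"
    by (rule rc_lax) (simp_all add: f ob dg_closed)
  then show ?thesis
    using ob f kernel_closed[OF f] dg_lax[OF f]
    by (simp add: eqrel_def kernel_re[OF f] dg_closed rc_dg_right cv_re[OF f f] cv_dg le_reflI)
qed

text \<open>
  One half of the equality holds for every arrow: graphs are single-valued.
\<close>

lemma descent_eq:
  assumes f: "f \<in> Hom R X A"
  shows "descent R f \<longleftrightarrow> rc R A X A (cograph R f) (graph R f) = dg R A"
proof -
  note ob = Hom_Ob[OF f]
  have "le R A A (rc R A X A (re R (Idn R A) f (dg R A)) (re R f (Idn R A) (dg R A)))
     (re R (Idn R A) (Idn R A) (rc R A A A (dg R A) (dg R A)))"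
    by (rule rc_lax) (simp_all add: f ob dg_closed Idn_in_Hom)
  then have "le R A A (rc R A X A (cograph R f) (graph R f)) (dg R A)"
    by (simp add: graph_Hom[OF f] cograph_re[OF f] re_Idn rc_dg_right dg_closed ob)
  then show ?thesis
    using ob rc_closed[OF ob(2,1,2) cograph_closed[OF f] graph_closed[OF f]] dg_closed[OF ob(2)]
    by (auto simp: descent_def Hom_Dom_Cod[OF f] le_antisymI le_reflI)
qed

text \<open>
  Composing with the converse of the graph of \<open>f\<close> and the graph of \<open>g\<close> is always a candidate for
  inverting reindexing along \<open>(f, g)\<close>; descent is what cancels the two pairs of graphs.
\<close>

lemma descent_recover:
  assumes f: "f \<in> Hom R X A" "descent R f" and g: "g \<in> Hom R Y B" "descent R g"
    and a: "\<alpha> \<in> fib R A B"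
  shows "rc R A Y B (rc R A X Y (cograph R f) (re R f g \<alpha>)) (graph R g) = \<alpha>"
proof -
  note ob [simp] = Hom_Ob[OF f(1)] Hom_Ob[OF g(1)]
  note c [simp] = a graph_closed[OF f(1)] cograph_closed[OF f(1)]
    graph_closed[OF g(1)] cograph_closed[OF g(1)]
  have 1: "rc R B Y B (cograph R g) (graph R g) = dg R B"
    using descent_eq[OF g(1)] g(2) by simp
  have "rc R A X B (cograph R f) (rc R X A B (graph R f) \<alpha>) =
      rc R A A B (rc R A X A (cograph R f) (graph R f)) \<alpha>"
    by (simp add: rc_assoc)
  also have "\<dots> = \<alpha>"
    using descent_eq[OF f(1)] f(2) by (simp add: rc_dg_left)
  finally have 2: "rc R A X B (cograph R f) (rc R X A B (graph R f) \<alpha>) = \<alpha>" .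
  have c': "rc R X A B (graph R f) \<alpha> \<in> fib R X B" by (simp add: rc_closed)
  have "rc R A X Y (cograph R f) (rc R X B Y (rc R X A B (graph R f) \<alpha>) (cograph R g))
     = rc R A B Y (rc R A X B (cograph R f) (rc R X A B (graph R f) \<alpha>)) (cograph R g)"
    by (rule rc_assoc[symmetric]) (use c' in simp_all)
  also have "\<dots> = rc R A B Y \<alpha> (cograph R g)" using 2 by simp
  finally show ?thesis
    using re_via_graphs[OF f(1) g(1) a] by (simp add: rc_assoc 1 rc_dg_right)
qed

lemma descent_reflect:
  assumes f: "f \<in> Hom R X A" "descent R f" and g: "g \<in> Hom R Y B" "descent R g"
    and ab: "\<alpha> \<in> fib R A B" "\<beta> \<in> fib R A B"
    and le: "le R X Y (re R f g \<alpha>) (re R f g \<beta>)"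
  shows "le R A B \<alpha> \<beta>"
proof -
  note ob [simp] = Hom_Ob[OF f(1)] Hom_Ob[OF g(1)]
  note c [simp] = ab cograph_closed[OF f(1)] graph_closed[OF g(1)]
    re_closed[OF f(1) g(1) ab(1)] re_closed[OF f(1) g(1) ab(2)]
  have "le R A B (rc R A Y B (rc R A X Y (cograph R f) (re R f g \<alpha>)) (graph R g))
     (rc R A Y B (rc R A X Y (cograph R f) (re R f g \<beta>)) (graph R g))"
    by (intro rc_mono) (simp_all add: rc_closed le le_reflI)
  then show ?thesis
    using descent_recover[OF f g ab(1)] descent_recover[OF f g ab(2)] by simp
qed

text \<open>
  For a descent arrow in the middle, composition is strictly natural: a witness in \<open>B\<close> of the composite
  relation comes from one in \<open>Y\<close>.
\<close>

lemma descent_re_rc: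
  assumes f: "f \<in> Hom R X A" and g: "g \<in> Hom R Y B" "descent R g" and h: "h \<in> Hom R Z E"
    and a: "\<alpha> \<in> fib R A B" and b: "\<beta> \<in> fib R B E"
  shows "rc R X Y Z (re R f g \<alpha>) (re R g h \<beta>) = re R f h (rc R A B E \<alpha> \<beta>)"
proof -
  note ob [simp] = Hom_Ob[OF f] Hom_Ob[OF g(1)] Hom_Ob[OF h]
  note c [simp] = a b graph_closed[OF f] graph_closed[OF g(1)] cograph_closed[OF g(1)]
     cograph_closed[OF h]
  note c' [simp] = rc_closed[OF ob(4) ob(6) ob(5) b c(6)]
  have "rc R B Y Z (cograph R g) (rc R Y B Z (graph R g) (rc R B E Z \<beta> (cograph R h)))
     = rc R B B Z (rc R B Y B (cograph R g) (graph R g)) (rc R B E Z \<beta> (cograph R h))"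
    by (rule rc_assoc[symmetric]) simp_all
  also have "\<dots> = rc R B E Z \<beta> (cograph R h)"
    using g(2) by (simp add: descent_eq[OF g(1)] rc_dg_left)
  finally show ?thesis
    by (simp add: re_via_graphs[OF f g(1) a] re_via_graphs[OF g(1) h b]
        re_via_graphs[OF f h] rc_closed rc_assoc)
qed

lemma re_Idn_right:
  assumes f: "f \<in> Hom R X A" and a: "\<alpha> \<in> fib R A B" and B: "B \<in> Ob R"
  shows "re R f (Idn R B) \<alpha> = rc R X A B (graph R f) \<alpha>"
proof -
  have "cograph R (Idn R B) = dg R B"
    using B by (simp add: cograph_re[of _ B B] Idn_in_Hom re_Idn dg_closed)
  then show ?thesis
    using re_via_graphs[OF f Idn_in_Hom[OF B] a] Hom_Ob[OF f] B a graph_closed[OF f]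
    by (simp add: rc_closed rc_dg_right)
qed

lemma graph_Comp:
  assumes f: "f \<in> Hom R X A" and g: "g \<in> Hom R A B"
  shows "graph R (Comp R g f) = rc R X A B (graph R f) (graph R g)"
proof -
  note ob = Hom_Ob[OF f] Hom_Ob[OF g]
  have "graph R (Comp R g f) = re R (Comp R g f) (Comp R (Idn R B) (Idn R B)) (dg R B)"
    using graph_Hom[OF Comp_in_Hom[OF f g]] Comp_Idn_left[OF Idn_in_Hom[OF ob(4)]] by simp
  also have "\<dots> = re R f (Idn R B) (graph R g)"
    unfolding graph_Hom[OF g] using ob f g
    by (intro re_Comp[of f X A g B "Idn R B" B B "Idn R B" B]) (simp_all add: Idn_in_Hom dg_closed)
  also have "\<dots> = rc R X A B (graph R f) (graph R g)"
    by (rule re_Idn_right) (use f g ob in \<open>simp_all add: graph_closed\<close>)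
  finally show ?thesis .
qed

lemma descent_Comp:
  assumes f: "f \<in> Hom R X A" "descent R f" and g: "g \<in> Hom R A B" "descent R g"
  shows "descent R (Comp R g f)"
proof -
  note ob [simp] = Hom_Ob[OF f(1)] Hom_Ob[OF g(1)]
  note c [simp] = graph_closed[OF f(1)] graph_closed[OF g(1)]
    cograph_closed[OF f(1)] cograph_closed[OF g(1)]
  have gf: "Comp R g f \<in> Hom R X B" using Comp_in_Hom[OF f(1) g(1)] .
  have co: "cograph R (Comp R g f) = rc R B A X (cograph R g) (cograph R f)"
    by (simp add: cograph_Hom[OF gf] graph_Comp[OF f(1) g(1)] cv_rc
        cograph_Hom[OF f(1)] cograph_Hom[OF g(1)])
  have "rc R A X B (cograph R f) (rc R X A B (graph R f) (graph R g))
     = rc R A A B (rc R A X A (cograph R f) (graph R f)) (graph R g)"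
    by (simp add: rc_assoc)
  also have "\<dots> = graph R g" using f(2) by (simp add: descent_eq[OF f(1)] rc_dg_left)
  finally show ?thesis
    using g(2) unfolding descent_eq[OF gf] descent_eq[OF g(1)]
    by (simp add: co graph_Comp[OF f(1) g(1)] rc_assoc rc_closed)
qed

lemma kernel_inverse_pair:
  assumes e: "inverse_pair R e e' X Y"
  shows "kernel R e = dg R X"
proof (rule le_antisymI)
  note e = inverse_pairD[OF e]
  show "le R X X (kernel R e) (dg R X)"
    using kernel_Comp_mono[OF e(1,2)] e(3,5) by (simp add: kernel_Idn)
  show "le R X X (dg R X) (kernel R e)"
    using dg_lax[OF e(1)] kernel_re[OF e(1)] by simp
qed (use inverse_pairD[OF e] in \<open>simp_all add: kernel_closed dg_closed\<close>)

text \<open>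
  The converse of the graph of an isomorphism is the graph of the inverse.
\<close>

lemma inverse_pair_descent:
  assumes e: "inverse_pair R e e' X Y"
  shows "descent R e"
proof -
  note D [simp] = inverse_pairD[OF e]
  note i [simp] = Idn_in_Hom[OF D(5)] Idn_in_Hom[OF D(6)]
  note [simp] = graph_closed[OF D(1)] dg_closed[OF D(6)]
  have "cograph R e = re R (Comp R e e') (Comp R e (Idn R X)) (dg R Y)"
    by (simp add: cograph_re[OF D(1)] Comp_Idn_right[OF D(1)])
  also have "\<dots> = re R e' (Idn R X) (re R e e (dg R Y))"
    by (rule re_Comp[OF D(2,1) i(1) D(1)]) simp_all
  also have "\<dots> = graph R e'"
    using kernel_inverse_pair[OF e] by (simp add: graph_Hom[OF D(2)] kernel_re[OF D(1)])
  finally have "rc R Y X Y (cograph R e) (graph R e) = graph R (Comp R e e')"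
    by (simp only: graph_Comp[OF D(2,1)])
  then show ?thesis
    by (simp add: descent_eq[OF D(1)] graph_Hom[OF i(2)] re_Idn)
qed

end

section \<open>Quotient arrows\<close>

context relational_doctrine
begin

lemma eqrelD:
  assumes "eqrel R X \<rho>"
  shows "X \<in> Ob R" "\<rho> \<in> fib R X X" "le R X X (dg R X) \<rho>" "le R X X (cv R X X \<rho>) \<rho>"
    "le R X X (rc R X X X \<rho> \<rho>) \<rho>"
  using assms by (auto simp: eqrel_def)

lemma eqrel_sym:
  assumes e: "eqrel R X \<rho>"
  shows "cv R X X \<rho> = \<rho>"
proof -
  note E [simp] = eqrelD[OF e]
  have [simp]: "cv R X X \<rho> \<in> fib R X X" by (simp add: cv_closed)
  have "le R X X (cv R X X (cv R X X \<rho>)) (cv R X X \<rho>)"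
    by (rule cv_monoI) simp_all
  then show ?thesis by (intro le_antisymI[of X X]) (simp_all add: cv_cv)
qed

lemma eqrel_idem:
  assumes e: "eqrel R X \<rho>"
  shows "rc R X X X \<rho> \<rho> = \<rho>"
proof -
  note E [simp] = eqrelD[OF e]
  have "le R X X (rc R X X X (dg R X) \<rho>) (rc R X X X \<rho> \<rho>)"
    by (rule rc_mono) (simp_all add: dg_closed le_reflI)
  then show ?thesis by (intro le_antisymI[of X X]) (simp_all add: rc_closed rc_dg_left)
qed

lemma eqrel_re:
  assumes e: "eqrel R X \<rho>" and f: "f \<in> Hom R Y X"
  shows "eqrel R Y (re R f f \<rho>)"
proof -
  note E [simp] = eqrelD[OF e]
  note ob [simp] = Hom_Ob[OF f]
  have [simp]: "re R f f \<rho> \<in> fib R Y Y" "dg R Y \<in> fib R Y Y" "re R f f (dg R X) \<in> fib R Y Y"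
    using f by (simp_all add: re_closed[OF f f] dg_closed)
  have 1: "le R Y Y (dg R Y) (re R f f \<rho>)"
    by (rule le_transI[OF dg_lax[OF f] re_monoI[OF E(3) f f]]) (simp_all add: dg_closed)
  have "le R Y Y (rc R Y Y Y (re R f f \<rho>) (re R f f \<rho>)) (re R f f (rc R X X X \<rho> \<rho>))"
    by (rule rc_lax) (simp_all add: f)
  then show ?thesis
    using 1 by (simp add: eqrel_def cv_re[OF f f] eqrel_sym[OF e] eqrel_idem[OF e] le_reflI)
qed

lemma quotient_arrowD:
  assumes "quotient_arrow R X \<rho> q W"
  shows "eqrel R X \<rho>" "q \<in> Hom R X W" "le R X X \<rho> (kernel R q)" "X \<in> Ob R" "W \<in> Ob R"
    "\<rho> \<in> fib R X X"
  using assms Hom_Ob[of q X W] eqrelD[of X \<rho>] by (auto simp: quotient_arrow_def)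

lemma quotient_factor:
  assumes "quotient_arrow R X \<rho> q W" "f \<in> Hom R X Z" "le R X X \<rho> (kernel R f)"
  obtains h where "h \<in> Hom R W Z" "Comp R h q = f"
proof -
  have "\<exists>!h. h \<in> Hom R W Z \<and> f = Comp R h q"
    using assms Hom_Ob(2)[OF assms(2)] unfolding quotient_arrow_def by blast
  then show thesis using that by blast
qed

lemma le_kernel_Comp:
  assumes q: "quotient_arrow R X \<rho> q W" and h: "h \<in> Hom R W Z"
  shows "le R X X \<rho> (kernel R (Comp R h q))"
proof -
  note D = quotient_arrowD[OF q]
  show ?thesis
    by (rule le_transI[OF D(3) kernel_Comp_mono[OF D(2) h]])
      (use D kernel_closed[OF D(2)] kernel_closed[OF Comp_in_Hom[OF D(2) h]] in simp_all)
qed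

lemma quotient_cancel:
  assumes q: "quotient_arrow R X \<rho> q W" and h: "h \<in> Hom R W Z" "h' \<in> Hom R W Z"
    and eq: "Comp R h q = Comp R h' q"
  shows "h = h'"
proof -
  have "Comp R h q \<in> Hom R X Z" using Comp_in_Hom[OF quotient_arrowD(2)[OF q] h(1)] .
  then have "\<exists>!k. k \<in> Hom R W Z \<and> Comp R h q = Comp R k q"
    using q le_kernel_Comp[OF q h(1)] Hom_Ob(2)[OF h(1)] unfolding quotient_arrow_def by blast
  then show ?thesis using h eq by blast
qed

text \<open>
  Existence and uniqueness of the factorization as separate obligations.
\<close>

lemma quotient_arrowI:
  assumes "eqrel R X \<rho>" "q \<in> Hom R X W" "le R X X \<rho> (kernel R q)"
    and "\<And>Z f. Z \<in> Ob R \<Longrightarrow> f \<in> Hom R X Z \<Longrightarrow> le R X X \<rho> (kernel R f) \<Longrightarrow>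
      \<exists>h. h \<in> Hom R W Z \<and> Comp R h q = f"
    and "\<And>Z h h'. Z \<in> Ob R \<Longrightarrow> h \<in> Hom R W Z \<Longrightarrow> h' \<in> Hom R W Z \<Longrightarrow>
      Comp R h q = Comp R h' q \<Longrightarrow> h = h'"
  shows "quotient_arrow R X \<rho> q W"
  unfolding quotient_arrow_def using assms by metis

text \<open>
  Factor each quotient arrow through the other; the factorizations are inverse to each other because
  quotient arrows are epimorphisms (\<open>quotient_cancel\<close>).
\<close>

lemma quotient_unique:
  assumes q: "quotient_arrow R X \<rho> q W" and q': "quotient_arrow R X \<rho> q' W'"
  obtains e e' where "inverse_pair R e e' W W'" "Comp R e q = q'" "Comp R e' q' = q"
proof -
  note D = quotient_arrowD[OF q] and D' = quotient_arrowD[OF q']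
  obtain e where e: "e \<in> Hom R W W'" "Comp R e q = q'"
    using quotient_factor[OF q D'(2,3)] .
  obtain e' where e': "e' \<in> Hom R W' W" "Comp R e' q' = q"
    using quotient_factor[OF q' D(2,3)] .
  have "Comp R e' e = Idn R W"
    using Comp_assoc[OF D(2) e(1) e'(1)] e e' D(5)
    by (intro quotient_cancel[OF q Comp_in_Hom[OF e(1) e'(1)] Idn_in_Hom])
      (simp_all add: Comp_Idn_left[OF D(2)])
  moreover have "Comp R e e' = Idn R W'"
    using Comp_assoc[OF D'(2) e'(1) e(1)] e e' D'(5)
    by (intro quotient_cancel[OF q' Comp_in_Hom[OF e'(1) e(1)] Idn_in_Hom])
      (simp_all add: Comp_Idn_left[OF D'(2)])
  ultimately show thesis using that e e' by (simp add: inverse_pair_def)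
qed

text \<open>
  Having quotients provides one effective descent quotient arrow of \<open>\<rho>\<close>. Any other one differs from it
  by an isomorphism, which changes neither the kernel nor the descent property.
\<close>

lemma quotient_effective_descent:
  assumes hq: "has_quotients R" and q: "quotient_arrow R X \<rho> q W"
  shows "kernel R q = \<rho>" "descent R q"
proof -
  note D = quotient_arrowD[OF q]
  obtain p V where p: "quotient_arrow R X \<rho> p V" "effective R \<rho> p" "descent R p"
    using hq D(1) unfolding has_quotients_def by blast
  obtain e e' where e: "inverse_pair R e e' V W" "Comp R e p = q"
    using quotient_unique[OF p(1) q] by metis
  note P = quotient_arrowD[OF p(1)] and E = inverse_pairD[OF e(1)]
  show "kernel R q = \<rho>"
    using kernel_Comp[OF P(2) E(1)] kernel_inverse_pair[OF e(1)] p(2) e(2)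
    by (simp add: effective_def kernel_re[OF P(2)])
  show "descent R q"
    using descent_Comp[OF P(2) p(3) E(1) inverse_pair_descent[OF e(1)]] e(2) by simp
qed

lemma quotient_Comp_iso:
  assumes q: "quotient_arrow R X \<rho> q W" and e: "inverse_pair R e e' W V"
  shows "quotient_arrow R X \<rho> (Comp R e q) V"
proof (rule quotient_arrowI)
  note D = quotient_arrowD[OF q] and E = inverse_pairD[OF e]
  show "eqrel R X \<rho>" "Comp R e q \<in> Hom R X V" "le R X X \<rho> (kernel R (Comp R e q))"
    using D(1) Comp_in_Hom[OF D(2) E(1)] le_kernel_Comp[OF q E(1)] .
  show "\<exists>h. h \<in> Hom R V Z \<and> Comp R h (Comp R e q) = f"
    if f: "f \<in> Hom R X Z" "le R X X \<rho> (kernel R f)" for Z f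
  proof -
    obtain h where h: "h \<in> Hom R W Z" "Comp R h q = f" using quotient_factor[OF q f] .
    have "Comp R (Comp R h e') (Comp R e q) = Comp R h (Comp R e' (Comp R e q))"
      using Comp_assoc[OF Comp_in_Hom[OF D(2) E(1)] E(2) h(1)] by simp
    also have "\<dots> = f" using cancel_inverse_left[OF e D(2)] h by simp
    finally show ?thesis using Comp_in_Hom[OF E(2) h(1)] by blast
  qed
  show "h = h'" if h: "h \<in> Hom R V Z" "h' \<in> Hom R V Z"
    and eq: "Comp R h (Comp R e q) = Comp R h' (Comp R e q)" for Z h h'
  proof -
    have "Comp R h e = Comp R h' e"
      using eq Comp_assoc[OF D(2) E(1) h(1)] Comp_assoc[OF D(2) E(1) h(2)]
      by (intro quotient_cancel[OF q Comp_in_Hom[OF E(1) h(1)] Comp_in_Hom[OF E(1) h(2)]]) metis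
    then show ?thesis
      using cancel_inverse_right[OF e h(1)] cancel_inverse_right[OF e h(2)] by metis
  qed
qed

lemma iso_Comp_quotient:
  assumes q: "quotient_arrow R X \<rho> q W" and e: "inverse_pair R e e' Y X"
  shows "quotient_arrow R Y (re R e e \<rho>) (Comp R q e) W"
proof (rule quotient_arrowI)
  note D = quotient_arrowD[OF q] and E = inverse_pairD[OF e]
  note k = kernel_closed[OF D(2)]
  note [simp] = re_closed[OF E(1) E(1) D(6)]
  show "eqrel R Y (re R e e \<rho>)" "Comp R q e \<in> Hom R Y W"
    using eqrel_re[OF D(1) E(1)] Comp_in_Hom[OF E(1) D(2)] .
  show "le R Y Y (re R e e \<rho>) (kernel R (Comp R q e))"
    using re_monoI[OF D(3) E(1) E(1) D(6) k] by (simp add: kernel_Comp[OF E(1) D(2)])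
  show "\<exists>h. h \<in> Hom R W Z \<and> Comp R h (Comp R q e) = f"
    if f: "f \<in> Hom R Y Z" and le: "le R Y Y (re R e e \<rho>) (kernel R f)" for Z f
  proof -
    have "re R e' e' (re R e e \<rho>) = \<rho>"
      using re_Comp[OF E(2) E(1) E(2) E(1) D(6)] E(4) D(4,6) by (simp add: re_Idn)
    then have "le R X X \<rho> (kernel R (Comp R f e'))"
      using re_monoI[OF le E(2) E(2)] kernel_closed[OF f] by (simp add: kernel_Comp[OF E(2) f])
    then obtain h where h: "h \<in> Hom R W Z" "Comp R h q = Comp R f e'"
      using quotient_factor[OF q Comp_in_Hom[OF E(2) f]] by metis
    have "Comp R h (Comp R q e) = Comp R (Comp R f e') e"
      using Comp_assoc[OF E(1) D(2) h(1)] h(2) by simp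
    also have "\<dots> = f" using cancel_inverse_right[OF inverse_pair_sym[OF e] f] .
    finally show ?thesis using h(1) by blast
  qed
  show "h = h'" if h: "h \<in> Hom R W Z" "h' \<in> Hom R W Z"
    and eq: "Comp R h (Comp R q e) = Comp R h' (Comp R q e)" for Z h h'
  proof -
    have "Comp R (Comp R h q) e = Comp R (Comp R h' q) e"
      using eq Comp_assoc[OF E(1) D(2) h(1)] Comp_assoc[OF E(1) D(2) h(2)] by metis
    then have "Comp R h q = Comp R h' q"
      using cancel_inverse_right[OF e Comp_in_Hom[OF D(2) h(1)]]
        cancel_inverse_right[OF e Comp_in_Hom[OF D(2) h(2)]] by metis
    then show ?thesis using quotient_cancel[OF q h] by simp
  qed
qed

text \<open>
  Factor a compatible arrow \<open>f\<close> first as \<open>g \<circ> q\<close>. That \<open>g\<close> is compatible with the kernel of \<open>p\<close> can be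
  checked after reindexing along \<open>q\<close>, because \<open>q\<close> is a descent arrow; there it is the compatibility
  of \<open>f\<close>.
\<close>

lemma quotient_Comp_quotient:
  assumes hq: "has_quotients R" and q: "quotient_arrow R X \<rho> q W"
    and p: "quotient_arrow R W \<sigma> p V"
  shows "quotient_arrow R X (kernel R (Comp R p q)) (Comp R p q) V"
proof (rule quotient_arrowI)
  note D = quotient_arrowD[OF q] and P = quotient_arrowD[OF p]
  note pq = Comp_in_Hom[OF D(2) P(2)]
  note QD = quotient_effective_descent[OF hq q] and PD = quotient_effective_descent[OF hq p]
  show "Comp R p q \<in> Hom R X V" "eqrel R X (kernel R (Comp R p q))"
    "le R X X (kernel R (Comp R p q)) (kernel R (Comp R p q))"
    using pq eqrel_kernel[OF pq] kernel_closed[OF pq] D(4) by (simp_all add: le_reflI)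
  show "\<exists>h. h \<in> Hom R V Z \<and> Comp R h (Comp R p q) = f"
    if f: "f \<in> Hom R X Z" and le: "le R X X (kernel R (Comp R p q)) (kernel R f)" for Z f
  proof -
    have "le R X X \<rho> (kernel R f)"
      by (rule le_transI[OF le_kernel_Comp[OF q P(2)] le])
        (use D kernel_closed[OF f] kernel_closed[OF pq] in simp_all)
    then obtain g where g: "g \<in> Hom R W Z" "Comp R g q = f" using quotient_factor[OF q f] by metis
    have "le R X X (re R q q (kernel R p)) (re R q q (kernel R g))"
      using le g(2) by (simp add: kernel_Comp[OF D(2) P(2)] kernel_Comp[OF D(2) g(1), symmetric])
    then have "le R W W (kernel R p) (kernel R g)"
      using descent_reflect[OF D(2) QD(2) D(2) QD(2)] kernel_closed[OF P(2)] kernel_closed[OF g(1)]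
      by simp
    then obtain h where h: "h \<in> Hom R V Z" "Comp R h p = g"
      using quotient_factor[OF p g(1)] PD(1) by metis
    then show ?thesis using Comp_assoc[OF D(2) P(2) h(1)] g(2) by auto
  qed
  show "h = h'" if h: "h \<in> Hom R V Z" "h' \<in> Hom R V Z"
    and eq: "Comp R h (Comp R p q) = Comp R h' (Comp R p q)" for Z h h'
  proof -
    have "Comp R h p = Comp R h' p"
      using eq Comp_assoc[OF D(2) P(2) h(1)] Comp_assoc[OF D(2) P(2) h(2)]
      by (intro quotient_cancel[OF q Comp_in_Hom[OF P(2) h(1)] Comp_in_Hom[OF P(2) h(2)]]) metis
    then show ?thesis using quotient_cancel[OF p h] by simp
  qed
qed

end

section \<open>Transport of doctrines along fully faithful maps\<close>

text \<open>
  The operations of \<open>T\<close> are raw data, closed on their carriers; \<open>K\<close> preserves them, is injective on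
  arrows and fibres and reflects the order. This is what is needed to pull every law back from \<open>R\<close>.
  It is used for the completion, where it replaces computations with representatives, and for the
  full subcategory of projective objects.
\<close>

locale doctrine_transport =
  R: relational_doctrine R
  for T :: "('o, 'a, 'r) doctrine" and R :: "('p, 'b, 's) doctrine"
    and K :: "('o, 'a, 'r, 'p, 'b, 's) rd_map" +
  assumes T_Dom: "f \<in> Ar T \<Longrightarrow> Dom T f \<in> Ob T"
    and T_Cod: "f \<in> Ar T \<Longrightarrow> Cod T f \<in> Ob T"
    and T_Idn: "X \<in> Ob T \<Longrightarrow> Idn T X \<in> Hom T X X"
    and T_Comp: "f \<in> Hom T X Y \<Longrightarrow> g \<in> Hom T Y Z \<Longrightarrow> Comp T g f \<in> Hom T X Z"
    and T_re: "f \<in> Hom T X A \<Longrightarrow> g \<in> Hom T Y B \<Longrightarrow> \<alpha> \<in> fib T A B \<Longrightarrow> re T f g \<alpha> \<in> fib T X Y"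
    and T_dg: "X \<in> Ob T \<Longrightarrow> dg T X \<in> fib T X X"
    and T_rc: "X \<in> Ob T \<Longrightarrow> Y \<in> Ob T \<Longrightarrow> Z \<in> Ob T \<Longrightarrow> \<alpha> \<in> fib T X Y \<Longrightarrow> \<beta> \<in> fib T Y Z \<Longrightarrow>
      rc T X Y Z \<alpha> \<beta> \<in> fib T X Z"
    and T_cv: "X \<in> Ob T \<Longrightarrow> Y \<in> Ob T \<Longrightarrow> \<alpha> \<in> fib T X Y \<Longrightarrow> cv T X Y \<alpha> \<in> fib T Y X"
    and K_Ob: "X \<in> Ob T \<Longrightarrow> FOb K X \<in> Ob R"
    and K_Hom: "f \<in> Hom T X Y \<Longrightarrow> FAr K f \<in> Hom R (FOb K X) (FOb K Y)"
    and K_Idn: "X \<in> Ob T \<Longrightarrow> FAr K (Idn T X) = Idn R (FOb K X)"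
    and K_Comp: "f \<in> Hom T X Y \<Longrightarrow> g \<in> Hom T Y Z \<Longrightarrow>
      FAr K (Comp T g f) = Comp R (FAr K g) (FAr K f)"
    and K_fib: "X \<in> Ob T \<Longrightarrow> Y \<in> Ob T \<Longrightarrow> \<alpha> \<in> fib T X Y \<Longrightarrow>
      FFib K X Y \<alpha> \<in> fib R (FOb K X) (FOb K Y)"
    and K_re: "f \<in> Hom T X A \<Longrightarrow> g \<in> Hom T Y B \<Longrightarrow> \<alpha> \<in> fib T A B \<Longrightarrow>
      FFib K X Y (re T f g \<alpha>) = re R (FAr K f) (FAr K g) (FFib K A B \<alpha>)"
    and K_dg: "X \<in> Ob T \<Longrightarrow> FFib K X X (dg T X) = dg R (FOb K X)"
    and K_rc: "X \<in> Ob T \<Longrightarrow> Y \<in> Ob T \<Longrightarrow> Z \<in> Ob T \<Longrightarrow> \<alpha> \<in> fib T X Y \<Longrightarrow> \<beta> \<in> fib T Y Z \<Longrightarrow>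
      FFib K X Z (rc T X Y Z \<alpha> \<beta>) =
        rc R (FOb K X) (FOb K Y) (FOb K Z) (FFib K X Y \<alpha>) (FFib K Y Z \<beta>)"
    and K_cv: "X \<in> Ob T \<Longrightarrow> Y \<in> Ob T \<Longrightarrow> \<alpha> \<in> fib T X Y \<Longrightarrow>
      FFib K Y X (cv T X Y \<alpha>) = cv R (FOb K X) (FOb K Y) (FFib K X Y \<alpha>)"
    and K_le: "X \<in> Ob T \<Longrightarrow> Y \<in> Ob T \<Longrightarrow> \<alpha> \<in> fib T X Y \<Longrightarrow> \<beta> \<in> fib T X Y \<Longrightarrow>
      le T X Y \<alpha> \<beta> \<longleftrightarrow> le R (FOb K X) (FOb K Y) (FFib K X Y \<alpha>) (FFib K X Y \<beta>)"
    and K_inj_Hom: "f \<in> Hom T X Y \<Longrightarrow> g \<in> Hom T X Y \<Longrightarrow> FAr K f = FAr K g \<Longrightarrow> f = g"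
    and K_inj_fib: "X \<in> Ob T \<Longrightarrow> Y \<in> Ob T \<Longrightarrow> \<alpha> \<in> fib T X Y \<Longrightarrow> \<beta> \<in> fib T X Y \<Longrightarrow>
      FFib K X Y \<alpha> = FFib K X Y \<beta> \<Longrightarrow> \<alpha> = \<beta>"
begin

lemma T_Ob: "f \<in> Hom T X Y \<Longrightarrow> X \<in> Ob T" "f \<in> Hom T X Y \<Longrightarrow> Y \<in> Ob T"
  using T_Dom T_Cod by (auto simp: Hom_def)

lemma transported_category: "category T"
proof
  fix f X Y assume f: "f \<in> Hom T X Y"
  note o [simp] = T_Ob[OF f]
  show "Comp T (Idn T Y) f = f"
    by (rule K_inj_Hom[OF T_Comp[OF f T_Idn] f])
      (simp_all add: K_Comp[OF f T_Idn] K_Idn R.Comp_Idn_left[OF K_Hom[OF f]])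
  show "Comp T f (Idn T X) = f"
    by (rule K_inj_Hom[OF T_Comp[OF T_Idn f] f])
      (simp_all add: K_Comp[OF T_Idn f] K_Idn R.Comp_Idn_right[OF K_Hom[OF f]])
next
  fix f X Y g Z h W assume f: "f \<in> Hom T X Y" and g: "g \<in> Hom T Y Z" and h: "h \<in> Hom T Z W"
  show "Comp T h (Comp T g f) = Comp T (Comp T h g) f"
    by (rule K_inj_Hom[OF T_Comp[OF T_Comp[OF f g] h] T_Comp[OF f T_Comp[OF g h]]])
      (simp add: K_Comp[OF T_Comp[OF f g] h] K_Comp[OF f T_Comp[OF g h]] K_Comp[OF f g]
        K_Comp[OF g h] R.Comp_assoc[OF K_Hom[OF f] K_Hom[OF g] K_Hom[OF h]])
qed (simp_all add: T_Dom T_Cod T_Idn T_Comp)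

lemma transported_doctrine: "relational_doctrine T"
proof (intro relational_doctrine.intro transported_category, unfold_locales)
  fix X Y assume [simp]: "X \<in> Ob T" "Y \<in> Ob T"
  note [simp] = K_Ob K_fib K_le
  show "reflp_on (fib T X Y) (le T X Y)"
    by (auto intro!: reflp_onI R.le_reflI)
  show "antisymp_on (fib T X Y) (le T X Y)"
    by (rule antisymp_onI, rule K_inj_fib[of X Y])
      (auto intro: R.le_antisymI[of "FOb K X" "FOb K Y"])
  show "transp_on (fib T X Y) (le T X Y)"
    by (rule transp_onI) (simp, rule R.le_transI, assumption, assumption, simp_all)
  show "monotone_on (fib T X Y) (le T X Y) (le T Y X) (cv T X Y)"
    by (rule monotone_onI) (simp add: K_cv T_cv R.cv_monoI)
  fix \<alpha> assume a [simp]: "\<alpha> \<in> fib T X Y"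
  show "re T (Idn T X) (Idn T Y) \<alpha> = \<alpha>"
    by (rule K_inj_fib[of X Y]) (simp_all add: T_re[OF T_Idn T_Idn] K_re[OF T_Idn T_Idn] K_Idn R.re_Idn)
  show "rc T X X Y (dg T X) \<alpha> = \<alpha>"
    by (rule K_inj_fib[of X Y]) (simp_all add: T_rc T_dg K_rc K_dg R.rc_dg_left)
  show "rc T X Y Y \<alpha> (dg T Y) = \<alpha>"
    by (rule K_inj_fib[of X Y]) (simp_all add: T_rc T_dg K_rc K_dg R.rc_dg_right)
  show "cv T Y X (cv T X Y \<alpha>) = \<alpha>"
    by (rule K_inj_fib[of X Y]) (simp_all add: T_cv K_cv R.cv_cv)
  fix Z assume [simp]: "Z \<in> Ob T"
  fix \<beta> assume [simp]: "\<beta> \<in> fib T Y Z"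
  show "cv T X Z (rc T X Y Z \<alpha> \<beta>) = rc T Z Y X (cv T Y Z \<beta>) (cv T X Y \<alpha>)"
    by (rule K_inj_fib[of Z X]) (simp_all add: T_cv K_cv T_rc K_rc R.cv_rc)
  {
    fix \<alpha>' \<beta>' assume "\<alpha>' \<in> fib T X Y" "\<beta>' \<in> fib T Y Z" "le T X Y \<alpha> \<alpha>'" "le T Y Z \<beta> \<beta>'"
    then show "le T X Z (rc T X Y Z \<alpha> \<beta>) (rc T X Y Z \<alpha>' \<beta>')"
      by (simp add: T_rc K_rc R.rc_mono)
  }
  fix W \<gamma> assume "W \<in> Ob T" "\<gamma> \<in> fib T Z W"
  then show "rc T X Z W (rc T X Y Z \<alpha> \<beta>) \<gamma> = rc T X Y W \<alpha> (rc T Y Z W \<beta> \<gamma>)"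
    by (intro K_inj_fib[of X W]) (simp_all add: T_rc K_rc R.rc_assoc)
next
  fix f X A g Y B assume f: "f \<in> Hom T X A" and g: "g \<in> Hom T Y B"
  note o [simp] = T_Ob[OF f] T_Ob[OF g]
  note K [simp] = K_Hom[OF f] K_Hom[OF g]
  note [simp] = K_Ob K_fib K_le K_re[OF f g] K_re[OF g f] T_re[OF f g] T_re[OF g f]
  show "monotone_on (fib T A B) (le T A B) (le T X Y) (re T f g)"
    by (rule monotone_onI) (simp add: R.re_monoI[OF _ K])
  fix \<alpha> assume [simp]: "\<alpha> \<in> fib T A B"
  show "le T Y X (cv T X Y (re T f g \<alpha>)) (re T g f (cv T A B \<alpha>))"
    by (simp add: T_cv K_cv R.cv_lax[OF K])
  fix h Z E \<beta> assume h: "h \<in> Hom T Z E" and [simp]: "\<beta> \<in> fib T B E"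
  note [simp] = T_Ob[OF h] K_re[OF g h] K_re[OF f h] T_re[OF g h] T_re[OF f h]
  show "le T X Z (rc T X Y Z (re T f g \<alpha>) (re T g h \<beta>)) (re T f h (rc T A B E \<alpha> \<beta>))"
    by (simp add: T_rc K_rc R.rc_lax[OF K K_Hom[OF h]])
next
  fix f' X' X f A g' Y' Y g B \<alpha>
  assume f: "f' \<in> Hom T X' X" "f \<in> Hom T X A" and g: "g' \<in> Hom T Y' Y" "g \<in> Hom T Y B"
    and a: "\<alpha> \<in> fib T A B"
  note [simp] = T_Ob[OF f(1)] T_Ob[OF f(2)] T_Ob[OF g(1)] T_Ob[OF g(2)]
  show "re T (Comp T f f') (Comp T g g') \<alpha> = re T f' g' (re T f g \<alpha>)"
    by (rule K_inj_fib[of X' Y'])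
      (simp_all add: T_re[OF T_Comp[OF f] T_Comp[OF g] a] T_re[OF f(1) g(1)] T_re[OF f(2) g(2) a]
        K_re[OF T_Comp[OF f] T_Comp[OF g] a] K_re[OF f(1) g(1)] K_re[OF f(2) g(2) a]
        K_Comp[OF f] K_Comp[OF g] K_fib[OF _ _ a]
        R.re_Comp[OF K_Hom[OF f(1)] K_Hom[OF f(2)] K_Hom[OF g(1)] K_Hom[OF g(2)]])
next
  fix f X Y assume f: "f \<in> Hom T X Y"
  show "le T X X (dg T X) (re T f f (dg T Y))"
    using T_Ob[OF f] R.dg_lax[OF K_Hom[OF f]]
    by (simp add: K_le T_dg T_re[OF f f] K_dg K_re[OF f f])
next
  fix X assume "X \<in> Ob T"
  then show "cv T X X (dg T X) = dg T X"
    by (intro K_inj_fib[of X X]) (simp_all add: T_cv T_dg K_cv K_dg R.cv_dg K_Ob)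
qed (simp_all add: T_re T_dg T_rc T_cv)

lemma transported_rd_arrow: "rd_arrow T R K"
proof (intro rd_arrow.intro transported_doctrine R.relational_doctrine_axioms, unfold_locales)
  fix X Y assume "X \<in> Ob T" "Y \<in> Ob T"
  then show "monotone_on (fib T X Y) (le T X Y) (le R (FOb K X) (FOb K Y)) (FFib K X Y)"
    by (auto intro!: monotone_onI simp: K_le)
qed (simp_all add: K_Ob K_Hom K_Idn K_Comp K_fib K_re K_dg K_rc K_cv)

end

section \<open>Fully faithful 1-arrows\<close>

locale ff_arrow = rd_arrow T R K
  for T :: "('o, 'a, 'r) doctrine" and R :: "('p, 'b, 's) doctrine"
    and K :: "('o, 'a, 'r, 'p, 'b, 's) rd_map" +
  assumes ff: "fully_faithful T R K"
begin

lemma Hom_inj: "f \<in> Hom T X Y \<Longrightarrow> g \<in> Hom T X Y \<Longrightarrow> FAr K f = FAr K g \<Longrightarrow> f = g"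
  using ff dom.Hom_Ob[of f X Y] unfolding fully_faithful_def bij_betw_def by (blast dest: inj_onD)

lemma Hom_lift:
  assumes "X \<in> Ob T" "Y \<in> Ob T" "h \<in> Hom R (FOb K X) (FOb K Y)"
  obtains f where "f \<in> Hom T X Y" "FAr K f = h"
proof -
  have "FAr K ` Hom T X Y = Hom R (FOb K X) (FOb K Y)"
    using ff assms(1,2) unfolding fully_faithful_def bij_betw_def by blast
  then show thesis using assms(3) that by (auto elim!: equalityE)
qed

lemma fib_inj: "X \<in> Ob T \<Longrightarrow> Y \<in> Ob T \<Longrightarrow> \<alpha> \<in> fib T X Y \<Longrightarrow> \<beta> \<in> fib T X Y \<Longrightarrow>
    FFib K X Y \<alpha> = FFib K X Y \<beta> \<Longrightarrow> \<alpha> = \<beta>"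
  using ff unfolding fully_faithful_def bij_betw_def by (blast dest: inj_onD)

lemma fib_lift:
  assumes "X \<in> Ob T" "Y \<in> Ob T" "\<beta> \<in> fib R (FOb K X) (FOb K Y)"
  obtains \<alpha> where "\<alpha> \<in> fib T X Y" "FFib K X Y \<alpha> = \<beta>"
proof -
  have "FFib K X Y ` fib T X Y = fib R (FOb K X) (FOb K Y)"
    using ff assms(1,2) unfolding fully_faithful_def bij_betw_def by blast
  then show thesis using assms(3) that by (auto elim!: equalityE)
qed

lemma le_iff: "X \<in> Ob T \<Longrightarrow> Y \<in> Ob T \<Longrightarrow> \<alpha> \<in> fib T X Y \<Longrightarrow> \<beta> \<in> fib T X Y \<Longrightarrow>
    le T X Y \<alpha> \<beta> \<longleftrightarrow> le R (FOb K X) (FOb K Y) (FFib K X Y \<alpha>) (FFib K X Y \<beta>)"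
  using ff unfolding fully_faithful_def by blast

lemma eqrel_iff:
  assumes "X \<in> Ob T" "\<rho> \<in> fib T X X"
  shows "eqrel T X \<rho> \<longleftrightarrow> eqrel R (FOb K X) (FFib K X X \<rho>)"
  using assms unfolding eqrel_def
  by (simp add: le_iff dom.dg_closed dom.cv_closed dom.rc_closed FFib_dg FFib_cv FFib_rc
      FOb_closed FFib_closed)

lemma FFib_graph:
  assumes f: "f \<in> Hom T X Y"
  shows "FFib K X Y (graph T f) = graph R (FAr K f)"
  using dom.Hom_Ob[OF f]
  by (simp add: dom.graph_Hom[OF f] cod.graph_Hom[OF FAr_closed[OF f]]
      FFib_natural[OF f dom.Idn_in_Hom] dom.dg_closed FAr_Idn FFib_dg)

lemma FFib_cograph:
  assumes f: "f \<in> Hom T X Y"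
  shows "FFib K Y X (cograph T f) = cograph R (FAr K f)"
  using dom.Hom_Ob[OF f]
  by (simp add: dom.cograph_Hom[OF f] cod.cograph_Hom[OF FAr_closed[OF f]]
      FFib_cv dom.graph_closed[OF f] FFib_graph[OF f])

lemma FFib_kernel:
  assumes f: "f \<in> Hom T X Y"
  shows "FFib K X X (kernel T f) = kernel R (FAr K f)"
  using dom.Hom_Ob[OF f]
  by (simp add: dom.kernel_re[OF f] cod.kernel_re[OF FAr_closed[OF f]] FFib_natural[OF f f]
      dom.dg_closed FFib_dg)

lemma descent_iff:
  assumes f: "f \<in> Hom T X Y"
  shows "descent T f \<longleftrightarrow> descent R (FAr K f)"
proof -
  note [simp] = dom.Hom_Ob[OF f] dom.graph_closed[OF f] dom.cograph_closed[OF f]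
  have "descent T f \<longleftrightarrow> FFib K Y Y (rc T Y X Y (cograph T f) (graph T f)) = FFib K Y Y (dg T Y)"
    by (auto simp: dom.descent_eq[OF f] dom.rc_closed dom.dg_closed dest: fib_inj[of Y Y, rotated 4])
  then show ?thesis
    by (simp add: cod.descent_eq[OF FAr_closed[OF f]] FFib_rc FFib_graph[OF f] FFib_cograph[OF f] FFib_dg)
qed

text \<open>
  By full faithfulness, the universal property of \<open>q\<close> in \<open>T\<close> is that of its image, tested on objects
  in the image of \<open>K\<close> only.
\<close>

lemma quotient_reflect:
  assumes q: "q \<in> Hom T X W" and r: "\<rho> \<in> fib T X X"
    and Q: "quotient_arrow R (FOb K X) (FFib K X X \<rho>) (FAr K q) (FOb K W)"
  shows "quotient_arrow T X \<rho> q W"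
proof (rule dom.quotient_arrowI)
  note o [simp] = dom.Hom_Ob[OF q]
  note D = cod.quotient_arrowD[OF Q]
  show "eqrel T X \<rho>" using eqrel_iff D(1) r o by simp
  show "q \<in> Hom T X W" by fact
  show "le T X X \<rho> (kernel T q)"
    using D(3) r dom.kernel_closed[OF q] by (simp add: le_iff FFib_kernel[OF q])
  show "\<exists>h. h \<in> Hom T W Z \<and> Comp T h q = f"
    if Z: "Z \<in> Ob T" and f: "f \<in> Hom T X Z" and le: "le T X X \<rho> (kernel T f)" for Z f
  proof -
    have "le R (FOb K X) (FOb K X) (FFib K X X \<rho>) (kernel R (FAr K f))"
      using le r dom.kernel_closed[OF f] by (simp add: le_iff FFib_kernel[OF f])
    then obtain h where h: "h \<in> Hom R (FOb K W) (FOb K Z)" "Comp R h (FAr K q) = FAr K f"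
      using cod.quotient_factor[OF Q FAr_closed[OF f]] by metis
    obtain u where u: "u \<in> Hom T W Z" "FAr K u = h" using Hom_lift[OF o(2) Z h(1)] .
    have "Comp T u q = f"
      using Hom_inj[OF dom.Comp_in_Hom[OF q u(1)] f] h(2) u(2) by (simp add: FAr_Comp[OF q u(1)])
    then show ?thesis using u(1) by blast
  qed
  show "h = h'" if h: "h \<in> Hom T W Z" "h' \<in> Hom T W Z" and eq: "Comp T h q = Comp T h' q"
    for Z h h'
    using cod.quotient_cancel[OF Q FAr_closed[OF h(1)] FAr_closed[OF h(2)]] eq Hom_inj[OF h]
      FAr_Comp[OF q h(1)] FAr_Comp[OF q h(2)] by simp
qed

end

section \<open>Essentially surjective fully faithful 1-arrows\<close>

locale ess_surj_arrow = ff_arrow T R K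
  for T :: "('o, 'a, 'r) doctrine" and R :: "('p, 'b, 's) doctrine"
    and K :: "('o, 'a, 'r, 'p, 'b, 's) rd_map" +
  assumes R_ext: "extensional R" and R_quot: "has_quotients R"
    and ess_surj: "X \<in> Ob R \<Longrightarrow> \<exists>A\<in>Ob T. \<exists>e e'. inverse_pair R e e' (FOb K A) X"
begin

text \<open>
  The universal property has to be tested on every object of \<open>R\<close>; replacing that object by an
  isomorphic one in the image of \<open>K\<close> only enlarges the kernel of the test arrow, and turns the test
  into one in \<open>T\<close>.
\<close>

lemma quotient_preserve:
  assumes Q: "quotient_arrow T X \<rho> q W"
  shows "quotient_arrow R (FOb K X) (FFib K X X \<rho>) (FAr K q) (FOb K W)"
proof (rule cod.quotient_arrowI)
  note D = dom.quotient_arrowD[OF Q]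
  note q = D(2) and o [simp] = D(4,5) and r [simp] = D(6)
  note Kq = FAr_closed[OF q]
  show "eqrel R (FOb K X) (FFib K X X \<rho>)" using eqrel_iff D(1) r o by simp
  show "FAr K q \<in> Hom R (FOb K X) (FOb K W)" by (rule Kq)
  show "le R (FOb K X) (FOb K X) (FFib K X X \<rho>) (kernel R (FAr K q))"
    using D(3) dom.kernel_closed[OF q] by (simp add: le_iff FFib_kernel[OF q])
  show "\<exists>h. h \<in> Hom R (FOb K W) Z \<and> Comp R h (FAr K q) = f"
    if Z: "Z \<in> Ob R" and f: "f \<in> Hom R (FOb K X) Z"
      and le: "le R (FOb K X) (FOb K X) (FFib K X X \<rho>) (kernel R f)" for Z f
  proof -
    obtain B e e' where B: "B \<in> Ob T" and e: "inverse_pair R e e' (FOb K B) Z"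
      using ess_surj[OF Z] by blast
    note E = cod.inverse_pairD[OF e]
    note ef = cod.Comp_in_Hom[OF f E(2)]
    obtain u where u: "u \<in> Hom T X B" "FAr K u = Comp R e' f" using Hom_lift[OF o(1) B ef] .
    have "le R (FOb K X) (FOb K X) (FFib K X X \<rho>) (kernel R (Comp R e' f))"
      by (rule cod.le_transI[OF le cod.kernel_Comp_mono[OF f E(2)]])
        (simp_all add: FOb_closed FFib_closed cod.kernel_closed[OF f] cod.kernel_closed[OF ef])
    then have "le T X X \<rho> (kernel T u)"
      using dom.kernel_closed[OF u(1)] by (simp add: le_iff FFib_kernel[OF u(1)] u(2))
    then obtain v where v: "v \<in> Hom T W B" "Comp T v q = u"
      using dom.quotient_factor[OF Q u(1)] by metis
    have "Comp R (Comp R e (FAr K v)) (FAr K q) = Comp R e (FAr K (Comp T v q))"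
      using cod.Comp_assoc[OF Kq FAr_closed[OF v(1)] E(1)] FAr_Comp[OF q v(1)] by simp
    also have "\<dots> = f"
      using v(2) u(2) cod.cancel_inverse_left[OF cod.inverse_pair_sym[OF e] f] by simp
    finally show ?thesis using cod.Comp_in_Hom[OF FAr_closed[OF v(1)] E(1)] by blast
  qed
  show "h = h'" if Z: "Z \<in> Ob R" and h: "h \<in> Hom R (FOb K W) Z" "h' \<in> Hom R (FOb K W) Z"
    and eq: "Comp R h (FAr K q) = Comp R h' (FAr K q)" for Z h h'
  proof -
    obtain B e e' where B: "B \<in> Ob T" and e: "inverse_pair R e e' (FOb K B) Z"
      using ess_surj[OF Z] by blast
    note E = cod.inverse_pairD[OF e]
    obtain v where v: "v \<in> Hom T W B" "FAr K v = Comp R e' h"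
      using Hom_lift[OF o(2) B cod.Comp_in_Hom[OF h(1) E(2)]] .
    obtain v' where v': "v' \<in> Hom T W B" "FAr K v' = Comp R e' h'"
      using Hom_lift[OF o(2) B cod.Comp_in_Hom[OF h(2) E(2)]] .
    have "FAr K (Comp T v q) = FAr K (Comp T v' q)"
      using cod.Comp_assoc[OF Kq h(1) E(2)] cod.Comp_assoc[OF Kq h(2) E(2)] eq v(2) v'(2)
        FAr_Comp[OF q v(1)] FAr_Comp[OF q v'(1)] by metis
    then have "Comp T v q = Comp T v' q"
      by (rule Hom_inj[OF dom.Comp_in_Hom[OF q v(1)] dom.Comp_in_Hom[OF q v'(1)]])
    then have "v = v'" by (rule dom.quotient_cancel[OF Q v(1) v'(1)])
    then show ?thesis
      using v(2) v'(2) cod.cancel_inverse_left[OF cod.inverse_pair_sym[OF e] h(1)]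
        cod.cancel_inverse_left[OF cod.inverse_pair_sym[OF e] h(2)] by simp
  qed
qed

lemma T_extensional: "extensional T"
  unfolding extensional_def
proof (intro ballI impI)
  fix X Y f g assume [simp]: "X \<in> Ob T" "Y \<in> Ob T" and f: "f \<in> Hom T X Y" and g: "g \<in> Hom T X Y"
    and le: "le T X X (dg T X) (re T f g (dg T Y))"
  have "le R (FOb K X) (FOb K X) (dg R (FOb K X)) (re R (FAr K f) (FAr K g) (dg R (FOb K Y)))"
    using le by (simp add: le_iff dom.dg_closed dom.re_closed[OF f g] FFib_natural[OF f g] FFib_dg)
  then have "FAr K f = FAr K g"
    using R_ext FAr_closed[OF f] FAr_closed[OF g] FOb_closed[of X] FOb_closed[of Y]
    unfolding extensional_def by simp
  then show "f = g" by (rule Hom_inj[OF f g])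
qed

text \<open>
  Take the quotient in \<open>R\<close> of the image of \<open>\<rho>\<close>, move its codomain into the image of \<open>K\<close> by an
  isomorphism, and lift.
\<close>

lemma T_has_quotients: "has_quotients T"
  unfolding has_quotients_def
proof (intro allI impI)
  fix X \<rho> assume "eqrel T X \<rho>"
  note E = dom.eqrelD[OF this] this
  have "eqrel R (FOb K X) (FFib K X X \<rho>)" using eqrel_iff E by simp
  then obtain q W where q: "quotient_arrow R (FOb K X) (FFib K X X \<rho>) q W"
    using R_quot unfolding has_quotients_def by blast
  obtain B e e' where B: "B \<in> Ob T" and e: "inverse_pair R e e' (FOb K B) W"
    using ess_surj[OF cod.quotient_arrowD(5)[OF q]] by blast
  note p = cod.quotient_Comp_iso[OF q cod.inverse_pair_sym[OF e]]
  obtain u where u: "u \<in> Hom T X B" "FAr K u = Comp R e' q"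
    using Hom_lift[OF E(1) B cod.quotient_arrowD(2)[OF p]] .
  note Ku = p[folded u(2)]
  note ED = cod.quotient_effective_descent[OF R_quot Ku]
  have "quotient_arrow T X \<rho> u B" using quotient_reflect[OF u(1) E(2) Ku] .
  moreover have "effective T \<rho> u"
    unfolding effective_def using ED(1) dom.kernel_closed[OF u(1)] E FFib_kernel[OF u(1)]
    by (intro fib_inj[of X X]) simp_all
  moreover have "descent T u" using ED(2) descent_iff[OF u(1)] by simp
  ultimately show "\<exists>q W. quotient_arrow T X \<rho> q W \<and> effective T \<rho> q \<and> descent T q" by blast
qed

lemma eqrd_arrow: "eqrd_arrow T R K"
  using R_ext R_quot T_extensional T_has_quotients quotient_preserve
    dom.relational_doctrine_axioms cod.relational_doctrine_axioms rd_arrow_axioms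
  by (simp add: eqrd_arrow_def eqrd_object_def preserves_quotient_arrows_def)

text \<open>
  The pseudo-inverse \<open>G\<close> sends \<open>X\<close> to an object \<open>g X\<close> with an isomorphism \<open>e X : K (g X) \<rightarrow> X\<close>, an
  arrow \<open>f\<close> to the lift of \<open>f\<close> conjugated by these isomorphisms, and a relation to the lift of its reindexing along
  them. All laws for \<open>G\<close> are verified after applying \<open>K\<close>. The isomorphism from \<open>K \<circ> G\<close> to the identity is
  \<open>e\<close> itself; the one from the identity to \<open>G \<circ> K\<close> is the lift of the inverses of \<open>e\<close>.
\<close>

lemma equivalence: "eqrd_equivalence T R K"
proof -
  have "\<forall>X\<in>Ob R. \<exists>A e e'. A \<in> Ob T \<and> inverse_pair R e e' (FOb K A) X"
    using ess_surj by blast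
  then obtain g e e' where g0: "\<forall>X\<in>Ob R. g X \<in> Ob T \<and> inverse_pair R (e X) (e' X) (FOb K (g X)) X"
    by metis
  have g: "g X \<in> Ob T" and e: "inverse_pair R (e X) (e' X) (FOb K (g X)) X" if "X \<in> Ob R" for X
    using g0 that by auto
  have E: "e X \<in> Hom R (FOb K (g X)) X" "e' X \<in> Hom R X (FOb K (g X))"
    "Comp R (e' X) (e X) = Idn R (FOb K (g X))" "Comp R (e X) (e' X) = Idn R X"
    if "X \<in> Ob R" for X
    using cod.inverse_pairD[OF e[OF that]] by auto
  define G where "G = \<lparr>FOb = g,
    FAr = (\<lambda>f. SOME u. u \<in> Hom T (g (Dom R f)) (g (Cod R f)) \<and>
       FAr K u = Comp R (e' (Cod R f)) (Comp R f (e (Dom R f)))),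
    FFib = (\<lambda>X Y \<alpha>. SOME \<beta>. \<beta> \<in> fib T (g X) (g Y) \<and>
       FFib K (g X) (g Y) \<beta> = re R (e X) (e Y) \<alpha>)\<rparr>"
  have G_Ob [simp]: "FOb G X = g X" for X by (simp add: G_def)
  have G_Hom: "FAr G f \<in> Hom T (g X) (g Y) \<and> FAr K (FAr G f) = Comp R (e' Y) (Comp R f (e X))"
    if f: "f \<in> Hom R X Y" for f X Y
  proof -
    note o = cod.Hom_Ob[OF f]
    have "\<exists>u. u \<in> Hom T (g X) (g Y) \<and> FAr K u = Comp R (e' Y) (Comp R f (e X))"
      using Hom_lift[OF g[OF o(1)] g[OF o(2)]
        cod.Comp_in_Hom[OF cod.Comp_in_Hom[OF E(1)[OF o(1)] f] E(2)[OF o(2)]]] by metis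
    from someI_ex[OF this] show ?thesis by (simp add: G_def cod.Hom_Dom_Cod[OF f])
  qed
  have G_fib: "FFib G X Y \<alpha> \<in> fib T (g X) (g Y) \<and>
      FFib K (g X) (g Y) (FFib G X Y \<alpha>) = re R (e X) (e Y) \<alpha>"
    if o: "X \<in> Ob R" "Y \<in> Ob R" and a: "\<alpha> \<in> fib R X Y" for X Y \<alpha>
  proof -
    have "\<exists>\<beta>. \<beta> \<in> fib T (g X) (g Y) \<and> FFib K (g X) (g Y) \<beta> = re R (e X) (e Y) \<alpha>"
      using fib_lift[OF g[OF o(1)] g[OF o(2)]
        cod.re_closed[OF E(1)[OF o(1)] E(1)[OF o(2)] a]] by metis
    from someI_ex[OF this] show ?thesis by (simp add: G_def)
  qed
  note GH = G_Hom[THEN conjunct1] and KG = G_Hom[THEN conjunct2]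
  note Gf = G_fib[THEN conjunct1] and KGf = G_fib[THEN conjunct2]
  \<comment> \<open>Naturality of \<open>e\<close> in the form in which the conjugations cancel.\<close>
  have conj: "Comp R (e Y) (Comp R (e' Y) (Comp R f (e X))) = Comp R f (e X)"
    if f: "f \<in> Hom R X Y" for f X Y
    using cod.cancel_inverse_left[OF cod.inverse_pair_sym[OF e] cod.Comp_in_Hom[OF E(1) f]]
      cod.Hom_Ob[OF f] by simp
  have re_conj: "re R (e' X) (e' Y) (re R (e X) (e Y) \<alpha>) = \<alpha>"
    if o: "X \<in> Ob R" "Y \<in> Ob R" and a: "\<alpha> \<in> fib R X Y" for X Y \<alpha>
    using cod.re_Comp[OF E(2,1)[OF o(1)] E(2,1)[OF o(2)] a] o a by (simp add: E cod.re_Idn)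
  interpret G: rd_arrow R T G
  proof
    fix X assume X: "X \<in> Ob R"
    show "FOb G X \<in> Ob T" using g[OF X] by simp
    note i = cod.Idn_in_Hom[OF X]
    have "FAr K (FAr G (Idn R X)) = FAr K (Idn T (g X))"
      by (simp add: KG[OF i] FAr_Idn g[OF X] cod.Comp_Idn_left[OF E(1)[OF X]] E(3)[OF X])
    then show "FAr G (Idn R X) = Idn T (FOb G X)"
      using Hom_inj[OF GH[OF i] dom.Idn_in_Hom[OF g[OF X]]] by simp
    have "FFib K (g X) (g X) (FFib G X X (dg R X)) = FFib K (g X) (g X) (dg T (g X))"
      using KGf[OF X X cod.dg_closed[OF X]] cod.kernel_inverse_pair[OF e[OF X]] g[OF X]
      by (simp add: FFib_dg cod.kernel_re[OF E(1)[OF X]])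
    then show "FFib G X X (dg R X) = dg T (FOb G X)"
      using fib_inj[OF g[OF X] g[OF X] Gf[OF X X cod.dg_closed[OF X]] dom.dg_closed[OF g[OF X]]]
      by simp
    fix Y assume Y: "Y \<in> Ob R"
    show "monotone_on (fib R X Y) (le R X Y) (le T (FOb G X) (FOb G Y)) (FFib G X Y)"
      by (rule monotone_onI) (simp add: le_iff g X Y Gf KGf cod.re_monoI[OF _ E(1)[OF X] E(1)[OF Y]])
    fix \<alpha> assume a: "\<alpha> \<in> fib R X Y"
    show "FFib G X Y \<alpha> \<in> fib T (FOb G X) (FOb G Y)" using Gf[OF X Y a] by simp
    note ca = cod.cv_closed[OF X Y a]
    have "FFib K (g Y) (g X) (FFib G Y X (cv R X Y \<alpha>))
       = FFib K (g Y) (g X) (cv T (g X) (g Y) (FFib G X Y \<alpha>))"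
      by (simp add: KGf[OF Y X ca] FFib_cv g X Y Gf[OF X Y a] KGf[OF X Y a]
          cod.cv_re[OF E(1)[OF X] E(1)[OF Y] a])
    then show "FFib G Y X (cv R X Y \<alpha>) = cv T (FOb G X) (FOb G Y) (FFib G X Y \<alpha>)"
      using fib_inj[OF g[OF Y] g[OF X] Gf[OF Y X ca] dom.cv_closed[OF g[OF X] g[OF Y] Gf[OF X Y a]]]
      by simp
    fix Z \<beta> assume Z: "Z \<in> Ob R" and b: "\<beta> \<in> fib R Y Z"
    note ab = cod.rc_closed[OF X Y Z a b]
    have "FFib K (g X) (g Z) (FFib G X Z (rc R X Y Z \<alpha> \<beta>))
       = FFib K (g X) (g Z) (rc T (g X) (g Y) (g Z) (FFib G X Y \<alpha>) (FFib G Y Z \<beta>))"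
      by (simp add: KGf[OF X Z ab] FFib_rc g X Y Z Gf[OF X Y a] KGf[OF X Y a] Gf[OF Y Z b] KGf[OF Y Z b]
          cod.descent_re_rc[OF E(1)[OF X] E(1)[OF Y] cod.inverse_pair_descent[OF e[OF Y]] E(1)[OF Z] a b])
    then show "FFib G X Z (rc R X Y Z \<alpha> \<beta>) =
        rc T (FOb G X) (FOb G Y) (FOb G Z) (FFib G X Y \<alpha>) (FFib G Y Z \<beta>)"
      using fib_inj[OF g[OF X] g[OF Z] Gf[OF X Z ab]
          dom.rc_closed[OF g[OF X] g[OF Y] g[OF Z] Gf[OF X Y a] Gf[OF Y Z b]]]
      by simp
  next
    fix f X Y assume f: "f \<in> Hom R X Y"
    show "FAr G f \<in> Hom T (FOb G X) (FOb G Y)" using GH[OF f] by simp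
    fix h Z assume h: "h \<in> Hom R Y Z"
    note o = cod.Hom_Ob[OF f] cod.Hom_Ob[OF h]
    note hf = cod.Comp_in_Hom[OF f h]
    note fe = cod.Comp_in_Hom[OF E(1)[OF o(1)] f]
    have "FAr K (Comp T (FAr G h) (FAr G f))
       = Comp R (Comp R (e' Z) (Comp R h (e Y))) (Comp R (e' Y) (Comp R f (e X)))"
      by (simp add: FAr_Comp[OF GH[OF f] GH[OF h]] KG[OF f] KG[OF h])
    also have "\<dots> = Comp R (e' Z) (Comp R (Comp R h (e Y)) (Comp R (e' Y) (Comp R f (e X))))"
      using cod.Comp_assoc[OF cod.Comp_in_Hom[OF fe E(2)[OF o(2)]]
          cod.Comp_in_Hom[OF E(1)[OF o(2)] h] E(2)[OF o(4)]] by simp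
    also have "\<dots> = Comp R (e' Z) (Comp R h (Comp R (e Y) (Comp R (e' Y) (Comp R f (e X)))))"
      using cod.Comp_assoc[OF cod.Comp_in_Hom[OF fe E(2)[OF o(2)]] E(1)[OF o(2)] h] by simp
    also have "\<dots> = Comp R (e' Z) (Comp R (Comp R h f) (e X))"
      using conj[OF f] cod.Comp_assoc[OF E(1)[OF o(1)] f h] by simp
    also have "\<dots> = FAr K (FAr G (Comp R h f))" using KG[OF hf] by simp
    finally show "FAr G (Comp R h f) = Comp T (FAr G h) (FAr G f)"
      using Hom_inj[OF GH[OF hf] dom.Comp_in_Hom[OF GH[OF f] GH[OF h]]] by simp
  next
    fix f X A h Y B \<alpha> assume f: "f \<in> Hom R X A" and h: "h \<in> Hom R Y B" and a: "\<alpha> \<in> fib R A B"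
    note o = cod.Hom_Ob[OF f] cod.Hom_Ob[OF h]
    note KGfH = FAr_closed[OF GH[OF f]] FAr_closed[OF GH[OF h]]
    note r = cod.re_closed[OF f h a]
    have "FFib K (g X) (g Y) (re T (FAr G f) (FAr G h) (FFib G A B \<alpha>))
       = re R (FAr K (FAr G f)) (FAr K (FAr G h)) (re R (e A) (e B) \<alpha>)"
      by (simp add: FFib_natural[OF GH[OF f] GH[OF h] Gf[OF o(2,4) a]] KGf[OF o(2,4) a])
    also have "\<dots> = re R (Comp R (e A) (FAr K (FAr G f))) (Comp R (e B) (FAr K (FAr G h))) \<alpha>"
      using cod.re_Comp[OF KGfH(1) E(1)[OF o(2)] KGfH(2) E(1)[OF o(4)] a] by simp
    also have "\<dots> = re R (Comp R f (e X)) (Comp R h (e Y)) \<alpha>"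
      by (simp add: KG[OF f] KG[OF h] conj[OF f] conj[OF h])
    also have "\<dots> = FFib K (g X) (g Y) (FFib G X Y (re R f h \<alpha>))"
      by (simp add: cod.re_Comp[OF E(1)[OF o(1)] f E(1)[OF o(3)] h a] KGf[OF o(1,3) r])
    finally show "FFib G X Y (re R f h \<alpha>) = re T (FAr G f) (FAr G h) (FFib G A B \<alpha>)"
      using fib_inj[OF g[OF o(1)] g[OF o(3)] Gf[OF o(1,3) r]
          dom.re_closed[OF GH[OF f] GH[OF h] Gf[OF o(2,4) a]]] by simp
  qed
  have "quotient_arrow T (g X) (FFib G X X \<rho>) (FAr G q) (g W)" if Q: "quotient_arrow R X \<rho> q W"
    for X \<rho> q W
  proof -
    note D = cod.quotient_arrowD[OF Q]
    have "quotient_arrow R (FOb K (g X)) (re R (e X) (e X) \<rho>)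
        (Comp R (e' W) (Comp R q (e X))) (FOb K (g W))"
      by (rule cod.quotient_Comp_iso[OF cod.iso_Comp_quotient[OF Q e[OF D(4)]]
          cod.inverse_pair_sym[OF e[OF D(5)]]])
    then show ?thesis
      by (intro quotient_reflect GH[OF D(2)] Gf[OF D(4,4,6)])
        (simp add: KG[OF D(2)] KGf[OF D(4,4,6)])
  qed
  then have G: "eqrd_arrow R T G"
    using eqrd_arrow G.rd_arrow_axioms by (simp add: eqrd_arrow_def preserves_quotient_arrows_def)
  have counit: "iso_one_arrows R R (rd_comp K G) rd_id"
    unfolding iso_one_arrows_def two_arrow_def rd_id_def rd_comp_def
  proof (rule exI[of _ e], rule exI[of _ e'], intro conjI ballI, simp_all add: E)
    fix X Y assume o: "X \<in> Ob R" "Y \<in> Ob R"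
    {
      fix f assume f: "f \<in> Hom R X Y"
      show "Comp R (e Y) (FAr K (FAr G f)) = Comp R f (e X)" by (simp add: KG[OF f] conj[OF f])
      show "Comp R (e' Y) f = Comp R (FAr K (FAr G f)) (e' X)"
        using cod.Comp_assoc[OF E(2)[OF o(1)] cod.Comp_in_Hom[OF E(1)[OF o(1)] f] E(2)[OF o(2)]]
          cod.cancel_inverse_right[OF e[OF o(1)] f]
        by (simp add: KG[OF f])
    }
    fix \<alpha> assume a: "\<alpha> \<in> fib R X Y"
    note r = cod.re_closed[OF E(1)[OF o(1)] E(1)[OF o(2)] a]
    show "le R (FOb K (g X)) (FOb K (g Y)) (FFib K (g X) (g Y) (FFib G X Y \<alpha>)) (re R (e X) (e Y) \<alpha>)"
      using r by (simp add: KGf[OF o a] FOb_closed g o cod.le_reflI)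
    show "le R X Y \<alpha> (re R (e' X) (e' Y) (FFib K (g X) (g Y) (FFib G X Y \<alpha>)))"
      using o a by (simp add: KGf[OF o a] re_conj cod.le_reflI)
  qed
  define t where "t X = (SOME u. u \<in> Hom T X (g (FOb K X)) \<and> FAr K u = e' (FOb K X))" for X
  define s where "s X = (SOME u. u \<in> Hom T (g (FOb K X)) X \<and> FAr K u = e (FOb K X))" for X
  have ts: "t X \<in> Hom T X (g (FOb K X))" "FAr K (t X) = e' (FOb K X)"
     "s X \<in> Hom T (g (FOb K X)) X" "FAr K (s X) = e (FOb K X)" if X: "X \<in> Ob T" for X
  proof -
    note KX = FOb_closed[OF X]
    have "\<exists>u. u \<in> Hom T X (g (FOb K X)) \<and> FAr K u = e' (FOb K X)"
      using Hom_lift[OF X g[OF KX] E(2)[OF KX]] by metis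
    from someI_ex[OF this] show "t X \<in> Hom T X (g (FOb K X))" "FAr K (t X) = e' (FOb K X)"
      by (simp_all add: t_def)
    have "\<exists>u. u \<in> Hom T (g (FOb K X)) X \<and> FAr K u = e (FOb K X)"
      using Hom_lift[OF g[OF KX] X E(1)[OF KX]] by metis
    from someI_ex[OF this] show "s X \<in> Hom T (g (FOb K X)) X" "FAr K (s X) = e (FOb K X)"
      by (simp_all add: s_def)
  qed
  have unit: "iso_one_arrows T T rd_id (rd_comp G K)"
    unfolding iso_one_arrows_def two_arrow_def rd_id_def rd_comp_def
  proof (rule exI[of _ t], rule exI[of _ s], intro conjI ballI, simp_all add: ts)
    fix X assume X: "X \<in> Ob T"
    note KX = FOb_closed[OF X]
    have "FAr K (Comp T (s X) (t X)) = FAr K (Idn T X)"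
      using X KX by (simp add: FAr_Comp[OF ts(1)[OF X] ts(3)[OF X]] ts E FAr_Idn)
    then show "Comp T (s X) (t X) = Idn T X"
      by (rule Hom_inj[OF dom.Comp_in_Hom[OF ts(1)[OF X] ts(3)[OF X]] dom.Idn_in_Hom[OF X]])
    have "FAr K (Comp T (t X) (s X)) = FAr K (Idn T (g (FOb K X)))"
      using X KX by (simp add: FAr_Comp[OF ts(3)[OF X] ts(1)[OF X]] ts E FAr_Idn g)
    then show "Comp T (t X) (s X) = Idn T (g (FOb K X))"
      by (rule Hom_inj[OF dom.Comp_in_Hom[OF ts(3)[OF X] ts(1)[OF X]] dom.Idn_in_Hom[OF g[OF KX]]])
    fix Y assume Y: "Y \<in> Ob T"
    note KY = FOb_closed[OF Y]
    {
      fix f assume f: "f \<in> Hom T X Y"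
      note Kf = FAr_closed[OF f]
      note GKf = GH[OF Kf]
      have "FAr K (Comp T (t Y) f) = Comp R (e' (FOb K Y)) (FAr K f)"
        using Y by (simp add: FAr_Comp[OF f ts(1)[OF Y]] ts)
      also have "\<dots> = FAr K (Comp T (FAr G (FAr K f)) (t X))"
        using cod.Comp_assoc[OF E(2)[OF KX] cod.Comp_in_Hom[OF E(1)[OF KX] Kf] E(2)[OF KY]]
          cod.cancel_inverse_right[OF e[OF KX] Kf]
        by (simp add: FAr_Comp[OF ts(1)[OF X] GKf] ts X KG[OF Kf])
      finally show "Comp T (t Y) f = Comp T (FAr G (FAr K f)) (t X)"
        by (rule Hom_inj[OF dom.Comp_in_Hom[OF f ts(1)[OF Y]] dom.Comp_in_Hom[OF ts(1)[OF X] GKf]])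
      have "FAr K (Comp T (s Y) (FAr G (FAr K f))) = FAr K (Comp T f (s X))"
        by (simp add: FAr_Comp[OF GKf ts(3)[OF Y]] FAr_Comp[OF ts(3)[OF X] f] ts X Y KG[OF Kf] conj[OF Kf])
      then show "Comp T (s Y) (FAr G (FAr K f)) = Comp T f (s X)"
        by (rule Hom_inj[OF dom.Comp_in_Hom[OF GKf ts(3)[OF Y]] dom.Comp_in_Hom[OF ts(3)[OF X] f]])
    }
    fix \<alpha> assume a: "\<alpha> \<in> fib T X Y"
    note Ka = FFib_closed[OF X Y a]
    note GKa = Gf[OF KX KY Ka]
    have "FFib K X Y (re T (t X) (t Y) (FFib G (FOb K X) (FOb K Y) (FFib K X Y \<alpha>))) = FFib K X Y \<alpha>"
      by (simp add: FFib_natural[OF ts(1)[OF X] ts(1)[OF Y] GKa] ts X Y KGf[OF KX KY Ka] re_conj[OF KX KY Ka])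
    then have "re T (t X) (t Y) (FFib G (FOb K X) (FOb K Y) (FFib K X Y \<alpha>)) = \<alpha>"
      by (rule fib_inj[OF X Y dom.re_closed[OF ts(1)[OF X] ts(1)[OF Y] GKa] a])
    then show "le T X Y \<alpha> (re T (t X) (t Y) (FFib G (FOb K X) (FOb K Y) (FFib K X Y \<alpha>)))"
      using X Y a by (simp add: dom.le_reflI)
    have "FFib K (g (FOb K X)) (g (FOb K Y)) (FFib G (FOb K X) (FOb K Y) (FFib K X Y \<alpha>))
      = FFib K (g (FOb K X)) (g (FOb K Y)) (re T (s X) (s Y) \<alpha>)"
      by (simp add: FFib_natural[OF ts(3)[OF X] ts(3)[OF Y] a] ts X Y KGf[OF KX KY Ka])
    then have "FFib G (FOb K X) (FOb K Y) (FFib K X Y \<alpha>) = re T (s X) (s Y) \<alpha>"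
      by (rule fib_inj[OF g[OF KX] g[OF KY] GKa dom.re_closed[OF ts(3)[OF X] ts(3)[OF Y] a]])
    then show "le T (g (FOb K X)) (g (FOb K Y)) (FFib G (FOb K X) (FOb K Y) (FFib K X Y \<alpha>))
        (re T (s X) (s Y) \<alpha>)"
      using GKa by (simp add: dom.le_reflI g KX KY)
  qed
  show ?thesis using eqrd_arrow G counit unit unfolding eqrd_equivalence_def by blast
qed

end

section \<open>The transpose of a fully faithful 1-arrow\<close>

locale transpose = F: ff_arrow S R F
  for S :: "('o, 'a, 'r) doctrine" and R :: "('p, 'b, 's) doctrine"
    and F :: "('o, 'a, 'r, 'p, 'b, 's) rd_map" +
  fixes q :: "'o \<times> 'r \<Rightarrow> 'b"
  assumes R_ext: "extensional R" and R_quot: "has_quotients R"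
    and choice: "quotient_choice S R F q"
begin

abbreviation T where "T \<equiv> eq_completion S"
abbreviation K where "K \<equiv> eq_transpose R F q"
abbreviation F0 where "F0 A \<equiv> FOb F (fst A)"

lemma completion_Ob: "Ob T = {A. eqrel S (fst A) (snd A)}"
  by (auto simp: eq_completion_def)

lemma q_quotient:
  "A \<in> Ob T \<Longrightarrow> quotient_arrow R (F0 A) (FFib F (fst A) (fst A) (snd A)) (q A) (FOb K A)"
  using choice by (cases A) (auto simp: quotient_choice_def completion_Ob eq_transpose_def)

lemma chosen_quotient:
  assumes "A \<in> Ob T"
  shows "fst A \<in> Ob S" "snd A \<in> fib S (fst A) (fst A)" "F0 A \<in> Ob R" "FOb K A \<in> Ob R"
    "FFib F (fst A) (fst A) (snd A) \<in> fib R (F0 A) (F0 A)"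
    "q A \<in> Hom R (F0 A) (FOb K A)" "descent R (q A)"
    "FFib F (fst A) (fst A) (snd A) = kernel R (q A)"
    "FFib F (fst A) (fst A) (snd A) = re R (q A) (q A) (dg R (FOb K A))"
  using assms F.dom.eqrelD[of "fst A" "snd A"] F.cod.quotient_arrowD[OF q_quotient[OF assms]]
    F.cod.quotient_effective_descent[OF R_quot q_quotient[OF assms]] F.cod.kernel_re[of "q A"]
  by (auto simp: completion_Ob)

definition represents :: "'o \<times> 'r \<Rightarrow> 'o \<times> 'r \<Rightarrow> 'a \<Rightarrow> bool" where
  "represents A B f \<longleftrightarrow> f \<in> Hom S (fst A) (fst B) \<and>
     le S (fst A) (fst A) (snd A) (re S f f (snd B))"

text \<open>
  The transpose \<open>h : K A \<rightarrow> K B\<close> of the class of \<open>f\<close> is determined by \<open>h \<circ> q A = qF B f\<close>.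
\<close>

definition qF :: "'o \<times> 'r \<Rightarrow> 'a \<Rightarrow> 'b" where
  "qF B f = Comp R (q B) (FAr F f)"

lemma qF_Hom: "B \<in> Ob T \<Longrightarrow> f \<in> Hom S X (fst B) \<Longrightarrow> qF B f \<in> Hom R (FOb F X) (FOb K B)"
  unfolding qF_def by (rule F.cod.Comp_in_Hom[OF F.FAr_closed chosen_quotient(6)])

text \<open>
  Effectiveness of \<open>q B\<close>: the image of the relation of \<open>B\<close> is the reindexed identity relation along
  \<open>q B\<close>.
\<close>

lemma le_re_iff_qF:
  assumes A: "A \<in> Ob T" and B: "B \<in> Ob T"
    and f: "f \<in> Hom S (fst A) (fst B)" and g: "g \<in> Hom S (fst A) (fst B)"
  shows "le S (fst A) (fst A) (snd A) (re S f g (snd B)) \<longleftrightarrow>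
    le R (F0 A) (F0 A) (FFib F (fst A) (fst A) (snd A)) (re R (qF B f) (qF B g) (dg R (FOb K B)))"
proof -
  note qA = chosen_quotient[OF A] and qB = chosen_quotient[OF B]
  have "FFib F (fst A) (fst A) (re S f g (snd B)) = re R (qF B f) (qF B g) (dg R (FOb K B))"
    using F.cod.re_Comp[OF F.FAr_closed[OF f] qB(6) F.FAr_closed[OF g] qB(6) F.cod.dg_closed[OF qB(4)]]
      F.FFib_natural[OF f g qB(2)] qB(9) by (simp add: qF_def)
  then show ?thesis
    using F.le_iff[OF qA(1) qA(1) qA(2) F.dom.re_closed[OF f g qB(2)]] by simp
qed

text \<open>
  The right-hand side is the universal property of \<open>q A\<close>: the representatives are the arrows for
  which a transpose exists.
\<close>

lemma represents_iff:
  assumes A: "A \<in> Ob T" and B: "B \<in> Ob T" and f: "f \<in> Hom S (fst A) (fst B)"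
  shows "represents A B f \<longleftrightarrow> (\<exists>h\<in>Hom R (FOb K A) (FOb K B). Comp R h (q A) = qF B f)"
proof -
  have "represents A B f \<longleftrightarrow>
      le R (F0 A) (F0 A) (FFib F (fst A) (fst A) (snd A)) (kernel R (qF B f))"
    using le_re_iff_qF[OF A B f f] f F.cod.kernel_re[OF qF_Hom[OF B f]] by (simp add: represents_def)
  then show ?thesis
    using F.cod.quotient_factor[OF q_quotient[OF A] qF_Hom[OF B f]]
      F.cod.le_kernel_Comp[OF q_quotient[OF A]] by metis
qed

text \<open>
  From left to right this is extensionality of \<open>R\<close>, because the identity relation lies below the image
  of the equivalence relation of \<open>A\<close>; conversely, equal composites make the condition for \<open>(f, g)\<close>
  the one for \<open>(f, f)\<close>.
\<close>

lemma same_class_iff: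
  assumes A: "A \<in> Ob T" and B: "B \<in> Ob T" and f: "represents A B f" and g: "represents A B g"
  shows "le S (fst A) (fst A) (snd A) (re S f g (snd B)) \<longleftrightarrow> qF B f = qF B g"
proof
  have f': "f \<in> Hom S (fst A) (fst B)" and g': "g \<in> Hom S (fst A) (fst B)"
    using f g by (auto simp: represents_def)
  note qA = chosen_quotient[OF A] and qB = chosen_quotient[OF B]
  note Q = qF_Hom[OF B f'] qF_Hom[OF B g']
  {
    assume "le S (fst A) (fst A) (snd A) (re S f g (snd B))"
    then have le: "le R (F0 A) (F0 A) (FFib F (fst A) (fst A) (snd A))
        (re R (qF B f) (qF B g) (dg R (FOb K B)))"
      by (simp add: le_re_iff_qF[OF A B f' g'])
    have "le R (F0 A) (F0 A) (dg R (F0 A)) (FFib F (fst A) (fst A) (snd A))"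
      using F.cod.eqrelD(3)[OF F.cod.quotient_arrowD(1)[OF q_quotient[OF A]]] .
    then have "le R (F0 A) (F0 A) (dg R (F0 A)) (re R (qF B f) (qF B g) (dg R (FOb K B)))"
      by (rule F.cod.le_transI[OF _ le])
        (use qA qB in \<open>simp_all add: F.cod.dg_closed F.cod.re_closed[OF Q]\<close>)
    then show "qF B f = qF B g"
      using R_ext Q qA(3) qB(4) unfolding extensional_def by blast
  next
    assume "qF B f = qF B g"
    then show "le S (fst A) (fst A) (snd A) (re S f g (snd B))"
      using f le_re_iff_qF[OF A B f' f'] le_re_iff_qF[OF A B f' g'] by (simp add: represents_def)
  }
qed

lemma arr_eq_iff:
  assumes A: "A \<in> Ob T" and B: "B \<in> Ob T"
  shows "(f, g) \<in> arr_eq S A B \<longleftrightarrow> represents A B f \<and> represents A B g \<and> qF B f = qF B g"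
proof -
  have "(f, g) \<in> arr_eq S A B \<longleftrightarrow>
      represents A B f \<and> represents A B g \<and> le S (fst A) (fst A) (snd A) (re S f g (snd B))"
    by (auto simp: arr_eq_def represents_def split: prod.splits)
  then show ?thesis using same_class_iff[OF A B] by blast
qed

lemma eq_class_cong:
  assumes "A \<in> Ob T" "B \<in> Ob T" "represents A B f" "represents A B g" "qF B f = qF B g"
  shows "eq_class S A f B = eq_class S A g B"
  using assms by (auto simp: eq_class_def arr_eq_iff)

lemma completion_HomD:
  assumes u: "u \<in> Hom T A B"
  shows "A \<in> Ob T" "B \<in> Ob T" "eq_src u = A" "eq_tgt u = B" "represents A B (eq_rep u)"
    "eq_class S A (eq_rep u) B = u"
proof -
  obtain c where c: "u = (A, c, B)" and h: "c \<in> eq_hom S A B" and A: "A \<in> Ob T" and B: "B \<in> Ob T"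
    using u unfolding completion_Ob by (cases u) (auto simp: Hom_def eq_completion_def)
  show "A \<in> Ob T" "B \<in> Ob T" "eq_src u = A" "eq_tgt u = B" using A B c by simp_all
  have "c \<in> {f. represents A B f} // arr_eq S A B"
    using h by (cases A; cases B) (simp add: eq_hom_def represents_def)
  then obtain f where f: "represents A B f" "c = arr_eq S A B `` {f}" by (auto elim: quotientE)
  then have "f \<in> c" using arr_eq_iff[OF A B] by simp
  then have "eq_rep u \<in> c" unfolding c eq_rep.simps by (rule someI)
  then have r: "represents A B (eq_rep u)" "qF B f = qF B (eq_rep u)"
    using f arr_eq_iff[OF A B] by auto
  then show "represents A B (eq_rep u)" by simp
  show "eq_class S A (eq_rep u) B = u"
    using eq_class_cong[OF A B f(1) r] f(2) c by (metis eq_class_def)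
qed

text \<open>
  The representative picked from a class need not be the \<open>f\<close> that generates it, but both have the
  same composite with \<open>q B\<close>, which is all that the transpose sees.
\<close>

lemma eq_class_Hom:
  assumes A: "A \<in> Ob T" and B: "B \<in> Ob T" and f: "represents A B f"
  shows "eq_class S A f B \<in> Hom T A B" "qF B (eq_rep (eq_class S A f B)) = qF B f"
proof -
  have "arr_eq S A B `` {f} \<in> eq_hom S A B"
    using quotientI[of f "{f. represents A B f}" "arr_eq S A B"] f
    by (cases A; cases B) (simp add: eq_hom_def represents_def)
  then show "eq_class S A f B \<in> Hom T A B"
    using A B unfolding completion_Ob
    by (auto simp: Hom_def eq_completion_def eq_class_def)
  have "f \<in> arr_eq S A B `` {f}" using f arr_eq_iff[OF A B] by simp
  then have "eq_rep (eq_class S A f B) \<in> arr_eq S A B `` {f}"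
    unfolding eq_class_def eq_rep.simps by (rule someI)
  then show "qF B (eq_rep (eq_class S A f B)) = qF B f"
    using arr_eq_iff[OF A B] by simp
qed

lemma rep_Hom: "u \<in> Hom T A B \<Longrightarrow> eq_rep u \<in> Hom S (fst A) (fst B)"
  using completion_HomD(5) by (auto simp: represents_def)

lemma transpose_arrow:
  assumes u: "u \<in> Hom T A B"
  shows "FAr K u \<in> Hom R (FOb K A) (FOb K B)" "Comp R (FAr K u) (q A) = qF B (eq_rep u)"
    "h \<in> Hom R (FOb K A) (FOb K B) \<Longrightarrow> Comp R h (q A) = qF B (eq_rep u) \<Longrightarrow> FAr K u = h"
proof -
  note D = completion_HomD[OF u]
  let ?P = "\<lambda>h. h \<in> Hom R (FOb K A) (FOb K B) \<and> Comp R h (q A) = qF B (eq_rep u)"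
  have K: "FAr K u = (THE h. ?P h)"
    by (simp add: eq_transpose_def D(3,4) qF_def)
  obtain h0 where h0: "?P h0" using represents_iff[OF D(1,2) rep_Hom[OF u]] D(5) by blast
  have uniq: "h = h0" if "?P h" for h
    using F.cod.quotient_cancel[OF q_quotient[OF D(1)], of h _ h0] that h0 by auto
  have Ku: "FAr K u = h0" unfolding K using h0 uniq by (rule the_equality)
  show "FAr K u \<in> Hom R (FOb K A) (FOb K B)" "Comp R (FAr K u) (q A) = qF B (eq_rep u)"
    unfolding Ku using h0 by blast+
  show "h \<in> Hom R (FOb K A) (FOb K B) \<Longrightarrow> Comp R h (q A) = qF B (eq_rep u) \<Longrightarrow> FAr K u = h"
    unfolding Ku using uniq by blast
qed

lemma transpose_eq_class:
  assumes A: "A \<in> Ob T" and B: "B \<in> Ob T" and f: "f \<in> Hom S (fst A) (fst B)"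
    and h: "h \<in> Hom R (FOb K A) (FOb K B)" "Comp R h (q A) = qF B f"
  shows "eq_class S A f B \<in> Hom T A B" "FAr K (eq_class S A f B) = h"
proof -
  have "represents A B f" using represents_iff[OF A B f] h by blast
  note c = eq_class_Hom[OF A B this]
  show "eq_class S A f B \<in> Hom T A B" "FAr K (eq_class S A f B) = h"
    using c transpose_arrow(3)[OF c(1) h(1)] h(2) by simp_all
qed

text \<open>
  Arrows with the same transpose have representatives with the same composite with \<open>q B\<close>, and these
  generate the same class.
\<close>

lemma K_faithful:
  assumes u: "u \<in> Hom T A B" and v: "v \<in> Hom T A B" and eq: "FAr K u = FAr K v"
  shows "u = v"
  using eq_class_cong[OF completion_HomD(1,2)[OF u] completion_HomD(5)[OF u] completion_HomD(5)[OF v]]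
    transpose_arrow(2)[OF u] transpose_arrow(2)[OF v] completion_HomD(6)[OF u] completion_HomD(6)[OF v] eq by metis

lemma completion_fibD: "\<alpha> \<in> fib T A B \<Longrightarrow> \<alpha> \<in> fib S (fst A) (fst B)"
  by (auto simp: eq_completion_def split: prod.splits)

lemma K_fib_eq: "FFib K A B \<alpha> = rc R (FOb K A) (F0 B) (FOb K B)
    (rc R (FOb K A) (F0 A) (F0 B) (cograph R (q A)) (FFib F (fst A) (fst B) \<alpha>)) (graph R (q B))"
  by (simp add: eq_transpose_def)

text \<open>
  The condition that \<open>\<alpha>\<close> absorbs the equivalence relations of \<open>A\<close> and \<open>B\<close> holds because the images of
  these relations are reindexed identity relations along \<open>q A\<close> and \<open>q B\<close>, and a reindexed relation
  absorbs them. Every operation on relations of the completion is treated through this criterion: it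
  suffices to name the relation \<open>\<beta>\<close> that the transpose should produce.
\<close>

lemma completion_fibI:
  assumes A: "A \<in> Ob T" and B: "B \<in> Ob T" and a: "\<alpha> \<in> fib S (fst A) (fst B)"
    and b: "\<beta> \<in> fib R (FOb K A) (FOb K B)" and eq: "re R (q A) (q B) \<beta> = FFib F (fst A) (fst B) \<alpha>"
  shows "\<alpha> \<in> fib T A B" "FFib K A B \<alpha> = \<beta>"
proof -
  note qA = chosen_quotient[OF A] and qB = chosen_quotient[OF B]
  show "FFib K A B \<alpha> = \<beta>"
    using F.cod.descent_recover[OF qA(6,7) qB(6,7) b] by (simp add: K_fib_eq eq)
  have sA: "cv S (fst A) (fst A) (snd A) = snd A"
    using F.dom.eqrel_sym A by (simp add: completion_Ob)
  let ?X = "fst A" and ?Y = "fst B"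
  note c1 = F.dom.rc_closed[OF qA(1) qA(1) qB(1) qA(2) a]
  note c2 = F.dom.rc_closed[OF qA(1) qB(1) qB(1) c1 qB(2)]
  have 1: "rc R (F0 A) (F0 A) (F0 B) (re R (q A) (q A) (dg R (FOb K A))) (re R (q A) (q B) \<beta>)
      = re R (q A) (q B) \<beta>"
    using F.cod.descent_re_rc[OF qA(6) qA(6,7) qB(6) F.cod.dg_closed[OF qA(4)] b]
      F.cod.rc_dg_left[OF qA(4) qB(4) b] by simp
  have 2: "rc R (F0 A) (F0 B) (F0 B) (re R (q A) (q B) \<beta>) (re R (q B) (q B) (dg R (FOb K B)))
      = re R (q A) (q B) \<beta>"
    using F.cod.descent_re_rc[OF qA(6) qB(6,7) qB(6) b F.cod.dg_closed[OF qB(4)]]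
      F.cod.rc_dg_right[OF qA(4) qB(4) b] by simp
  have "FFib F ?X ?Y (rc S ?X ?Y ?Y (rc S ?X ?X ?Y (snd A) \<alpha>) (snd B)) = FFib F ?X ?Y \<alpha>"
    using 1 2 by (simp add: F.FFib_rc qA(1,2) qB(1,2) a c1 eq[symmetric] qA(9) qB(9))
  then have "rc S ?X ?Y ?Y (rc S ?X ?X ?Y (snd A) \<alpha>) (snd B) = \<alpha>"
    by (rule F.fib_inj[OF qA(1) qB(1) c2 a])
  then show "\<alpha> \<in> fib T A B"
    using a sA F.dom.le_reflI[OF qA(1) qB(1) a]
    by (cases A; cases B) (simp add: eq_completion_def)
qed

text \<open>
  A relation in the completion is fixed by composition with the equivalence relations on both sides.
  Under \<open>F\<close> these become kernels, and regrouping the graphs in the resulting composite gives the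
  reindexing of the transpose.
\<close>

lemma transpose_fib:
  assumes A: "A \<in> Ob T" and B: "B \<in> Ob T" and a: "\<alpha> \<in> fib T A B"
  shows "FFib K A B \<alpha> \<in> fib R (FOb K A) (FOb K B)"
    "re R (q A) (q B) (FFib K A B \<alpha>) = FFib F (fst A) (fst B) \<alpha>"
proof -
  note qA = chosen_quotient[OF A] and qB = chosen_quotient[OF B]
  let ?X = "fst A" and ?Y = "fst B"
  note a' = completion_fibD[OF a]
  note Fa [simp] = F.FFib_closed[OF qA(1) qB(1) a']
  note g [simp] = F.cod.graph_closed[OF qA(6)] F.cod.cograph_closed[OF qA(6)]
    F.cod.graph_closed[OF qB(6)] F.cod.cograph_closed[OF qB(6)]
  note [simp] = qA(3,4) qB(3,4)
  note c1 = F.dom.rc_closed[OF qA(1) qA(1) qB(1) qA(2) a']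
  note c2 = F.dom.rc_closed[OF qA(1) qB(1) qB(1) c1 qB(2)]
  show K: "FFib K A B \<alpha> \<in> fib R (FOb K A) (FOb K B)"
    unfolding K_fib_eq by (simp add: F.cod.rc_closed)
  have eA: "eqrel S ?X (snd A)" and eB: "eqrel S ?Y (snd B)" using A B by (simp_all add: completion_Ob)
  have "le S ?X ?Y (rc S ?X ?Y ?Y (rc S ?X ?X ?Y (cv S ?X ?X (snd A)) \<alpha>) (snd B)) \<alpha>"
    using a by (auto simp: eq_completion_def split: prod.splits)
  then have 1: "le S ?X ?Y (rc S ?X ?Y ?Y (rc S ?X ?X ?Y (snd A) \<alpha>) (snd B)) \<alpha>"
    by (simp add: F.dom.eqrel_sym[OF eA])
  have "le S ?X ?Y (rc S ?X ?Y ?Y (rc S ?X ?X ?Y (dg S ?X) \<alpha>) (dg S ?Y))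
     (rc S ?X ?Y ?Y (rc S ?X ?X ?Y (snd A) \<alpha>) (snd B))"
    using qA qB a' F.dom.eqrelD(3)[OF eA] F.dom.eqrelD(3)[OF eB]
    by (intro F.dom.rc_mono) (simp_all add: F.dom.dg_closed F.dom.rc_closed F.dom.le_reflI)
  then have 2: "le S ?X ?Y \<alpha> (rc S ?X ?Y ?Y (rc S ?X ?X ?Y (snd A) \<alpha>) (snd B))"
    using qA qB a' by (simp add: F.dom.rc_dg_left F.dom.rc_dg_right)
  have 3: "rc S ?X ?Y ?Y (rc S ?X ?X ?Y (snd A) \<alpha>) (snd B) = \<alpha>"
    by (rule F.dom.le_antisymI[OF 1 2 qA(1) qB(1) c2 a'])
  have kA: "FFib F ?X ?X (snd A) = rc R (F0 A) (FOb K A) (F0 A) (graph R (q A)) (cograph R (q A))"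
    and kB: "FFib F ?Y ?Y (snd B) = rc R (F0 B) (FOb K B) (F0 B) (graph R (q B)) (cograph R (q B))"
    using qA(8) qB(8) F.cod.Hom_Dom_Cod[OF qA(6)] F.cod.Hom_Dom_Cod[OF qB(6)]
    by (simp_all add: kernel_def)
  have "FFib F ?X ?Y \<alpha> = rc R (F0 A) (F0 B) (F0 B)
     (rc R (F0 A) (F0 A) (F0 B) (FFib F ?X ?X (snd A)) (FFib F ?X ?Y \<alpha>)) (FFib F ?Y ?Y (snd B))"
    using arg_cong[OF 3, of "FFib F ?X ?Y"]
    by (simp add: F.FFib_rc qA(1,2) qB(1,2) a' c1)
  also have "\<dots> = re R (q A) (q B) (FFib K A B \<alpha>)"
    unfolding F.cod.re_via_graphs[OF qA(6) qB(6) K]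
    by (simp add: K_fib_eq kA kB F.cod.rc_assoc F.cod.rc_closed)
  finally show "re R (q A) (q B) (FFib K A B \<alpha>) = FFib F ?X ?Y \<alpha>" by simp
qed

lemma K_le:
  assumes A: "A \<in> Ob T" and B: "B \<in> Ob T" and a: "\<alpha> \<in> fib T A B" and b: "\<beta> \<in> fib T A B"
  shows "le T A B \<alpha> \<beta> \<longleftrightarrow> le R (FOb K A) (FOb K B) (FFib K A B \<alpha>) (FFib K A B \<beta>)"
proof -
  note qA = chosen_quotient[OF A] and qB = chosen_quotient[OF B]
  note Ka = transpose_fib[OF A B a] and Kb = transpose_fib[OF A B b]
  have "le T A B \<alpha> \<beta> \<longleftrightarrow> le R (F0 A) (F0 B) (FFib F (fst A) (fst B) \<alpha>) (FFib F (fst A) (fst B) \<beta>)"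
    using F.le_iff[OF qA(1) qB(1) completion_fibD[OF a] completion_fibD[OF b]] by (simp add: eq_completion_def)
  then show ?thesis
    using F.cod.descent_reflect[OF qA(6,7) qB(6,7) Ka(1) Kb(1)]
      F.cod.re_monoI[OF _ qA(6) qB(6) Ka(1) Kb(1)] Ka(2) Kb(2) by auto
qed

lemma T_ops:
  "Idn T A = eq_class S A (Idn S (fst A)) A"
  "Comp T v u = eq_class S (eq_src u) (Comp S (eq_rep v) (eq_rep u)) (eq_tgt v)"
  "re T u v = re S (eq_rep u) (eq_rep v)"
  "rc T A B E = rc S (fst A) (fst B) (fst E)"
  "cv T A B = cv S (fst A) (fst B)"
  "dg T A = snd A"
  by (simp_all add: eq_completion_def)

lemma K_Idn:
  assumes A: "A \<in> Ob T"
  shows "Idn T A \<in> Hom T A A" "FAr K (Idn T A) = Idn R (FOb K A)"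
proof -
  note qA = chosen_quotient[OF A]
  have "Comp R (Idn R (FOb K A)) (q A) = qF A (Idn S (fst A))"
    by (simp add: qF_def F.FAr_Idn[OF qA(1)] F.cod.Comp_Idn_left[OF qA(6)] F.cod.Comp_Idn_right[OF qA(6)])
  then show "Idn T A \<in> Hom T A A" "FAr K (Idn T A) = Idn R (FOb K A)"
    unfolding T_ops
    using transpose_eq_class[OF A A F.dom.Idn_in_Hom[OF qA(1)] F.cod.Idn_in_Hom[OF qA(4)]] by simp_all
qed

lemma K_Comp:
  assumes u: "u \<in> Hom T A B" and v: "v \<in> Hom T B E"
  shows "Comp T v u \<in> Hom T A E" "FAr K (Comp T v u) = Comp R (FAr K v) (FAr K u)"
proof -
  note D = completion_HomD[OF u] and D' = completion_HomD[OF v]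
  note qA = chosen_quotient[OF D(1)] and qB = chosen_quotient[OF D(2)] and qE = chosen_quotient[OF D'(2)]
  note r = rep_Hom[OF u] rep_Hom[OF v]
  note Fr = F.FAr_closed[OF r(1)] F.FAr_closed[OF r(2)]
  note KK = transpose_arrow[OF u] transpose_arrow[OF v]
  have "Comp R (Comp R (FAr K v) (FAr K u)) (q A) = Comp R (FAr K v) (qF B (eq_rep u))"
    using F.cod.Comp_assoc[OF qA(6) KK(1,4)] KK(2) by simp
  also have "\<dots> = Comp R (qF E (eq_rep v)) (FAr F (eq_rep u))"
    using F.cod.Comp_assoc[OF Fr(1) qB(6) KK(4)] KK(5) by (simp add: qF_def)
  also have "\<dots> = qF E (Comp S (eq_rep v) (eq_rep u))"
    using F.cod.Comp_assoc[OF Fr qE(6)] by (simp add: qF_def F.FAr_Comp[OF r])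
  finally show "Comp T v u \<in> Hom T A E" "FAr K (Comp T v u) = Comp R (FAr K v) (FAr K u)"
    unfolding T_ops D(3) D'(4)
    using transpose_eq_class[OF D(1) D'(2) F.dom.Comp_in_Hom[OF r] F.cod.Comp_in_Hom[OF KK(1,4)]]
    by simp_all
qed

lemma K_re:
  assumes u: "u \<in> Hom T A B" and v: "v \<in> Hom T E D" and a: "\<alpha> \<in> fib T B D"
  shows "re T u v \<alpha> \<in> fib T A E"
    "FFib K A E (re T u v \<alpha>) = re R (FAr K u) (FAr K v) (FFib K B D \<alpha>)"
proof -
  note D1 = completion_HomD[OF u] and D2 = completion_HomD[OF v]
  note qA = chosen_quotient[OF D1(1)] and qB = chosen_quotient[OF D1(2)]
    and qE = chosen_quotient[OF D2(1)] and qD = chosen_quotient[OF D2(2)]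
  note r = rep_Hom[OF u] rep_Hom[OF v]
  note Fr = F.FAr_closed[OF r(1)] F.FAr_closed[OF r(2)]
  note KK = transpose_arrow[OF u] transpose_arrow[OF v]
  note Ka = transpose_fib[OF D1(2) D2(2) a]
  note a' = completion_fibD[OF a]
  have "re R (q A) (q E) (re R (FAr K u) (FAr K v) (FFib K B D \<alpha>))
      = re R (qF B (eq_rep u)) (qF D (eq_rep v)) (FFib K B D \<alpha>)"
    using F.cod.re_Comp[OF qA(6) KK(1) qE(6) KK(4) Ka(1)] KK(2,5) by simp
  also have "\<dots> = FFib F (fst A) (fst E) (re S (eq_rep u) (eq_rep v) \<alpha>)"
    using F.cod.re_Comp[OF Fr(1) qB(6) Fr(2) qD(6) Ka(1)] Ka(2) F.FFib_natural[OF r a']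
    by (simp add: qF_def)
  finally show "re T u v \<alpha> \<in> fib T A E"
    "FFib K A E (re T u v \<alpha>) = re R (FAr K u) (FAr K v) (FFib K B D \<alpha>)"
    unfolding T_ops
    using completion_fibI[OF D1(1) D2(1) F.dom.re_closed[OF r a'] F.cod.re_closed[OF KK(1,4) Ka(1)]] by simp_all
qed

lemma K_dg:
  assumes A: "A \<in> Ob T"
  shows "dg T A \<in> fib T A A" "FFib K A A (dg T A) = dg R (FOb K A)"
  unfolding T_ops
  using completion_fibI[OF A A chosen_quotient(2)[OF A] F.cod.dg_closed[OF chosen_quotient(4)[OF A]] chosen_quotient(9)[OF A, symmetric]]
  by simp_all

lemma K_rc:
  assumes A: "A \<in> Ob T" and B: "B \<in> Ob T" and E: "E \<in> Ob T"
    and a: "\<alpha> \<in> fib T A B" and b: "\<beta> \<in> fib T B E"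
  shows "rc T A B E \<alpha> \<beta> \<in> fib T A E"
    "FFib K A E (rc T A B E \<alpha> \<beta>) =
       rc R (FOb K A) (FOb K B) (FOb K E) (FFib K A B \<alpha>) (FFib K B E \<beta>)"
proof -
  note qA = chosen_quotient[OF A] and qB = chosen_quotient[OF B] and qE = chosen_quotient[OF E]
  note Ka = transpose_fib[OF A B a] and Kb = transpose_fib[OF B E b]
  note a' = completion_fibD[OF a] and b' = completion_fibD[OF b]
  have "re R (q A) (q E) (rc R (FOb K A) (FOb K B) (FOb K E) (FFib K A B \<alpha>) (FFib K B E \<beta>))
      = FFib F (fst A) (fst E) (rc S (fst A) (fst B) (fst E) \<alpha> \<beta>)"
    using F.cod.descent_re_rc[OF qA(6) qB(6,7) qE(6) Ka(1) Kb(1)] Ka(2) Kb(2)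
      F.FFib_rc[OF qA(1) qB(1) qE(1) a' b'] by simp
  then show "rc T A B E \<alpha> \<beta> \<in> fib T A E"
    "FFib K A E (rc T A B E \<alpha> \<beta>) =
       rc R (FOb K A) (FOb K B) (FOb K E) (FFib K A B \<alpha>) (FFib K B E \<beta>)"
    unfolding T_ops
    using completion_fibI[OF A E F.dom.rc_closed[OF qA(1) qB(1) qE(1) a' b']
        F.cod.rc_closed[OF qA(4) qB(4) qE(4) Ka(1) Kb(1)]] by simp_all
qed

lemma K_cv:
  assumes A: "A \<in> Ob T" and B: "B \<in> Ob T" and a: "\<alpha> \<in> fib T A B"
  shows "cv T A B \<alpha> \<in> fib T B A" "FFib K B A (cv T A B \<alpha>) = cv R (FOb K A) (FOb K B) (FFib K A B \<alpha>)"
proof -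
  note qA = chosen_quotient[OF A] and qB = chosen_quotient[OF B]
  note Ka = transpose_fib[OF A B a] and a' = completion_fibD[OF a]
  have "re R (q B) (q A) (cv R (FOb K A) (FOb K B) (FFib K A B \<alpha>))
     = FFib F (fst B) (fst A) (cv S (fst A) (fst B) \<alpha>)"
    using F.cod.cv_re[OF qA(6) qB(6) Ka(1)] Ka(2) F.FFib_cv[OF qA(1) qB(1) a'] by simp
  then show "cv T A B \<alpha> \<in> fib T B A"
    "FFib K B A (cv T A B \<alpha>) = cv R (FOb K A) (FOb K B) (FFib K A B \<alpha>)"
    unfolding T_ops
    using completion_fibI[OF B A F.dom.cv_closed[OF qA(1) qB(1) a'] F.cod.cv_closed[OF qA(4) qB(4) Ka(1)]]
    by simp_all
qed

lemma transport: "doctrine_transport T R K"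
proof
  fix u :: "('o, 'a, 'r) eq_arr" assume "u \<in> Ar T"
  then have "u \<in> Hom T (Dom T u) (Cod T u)" by (simp add: Hom_def)
  from completion_HomD(1,2)[OF this] show "Dom T u \<in> Ob T" "Cod T u \<in> Ob T" .
next
  fix A B \<alpha> \<beta> assume A: "A \<in> Ob T" and B: "B \<in> Ob T" and a: "\<alpha> \<in> fib T A B" and b: "\<beta> \<in> fib T A B"
    and eq: "FFib K A B \<alpha> = FFib K A B \<beta>"
  show "\<alpha> = \<beta>"
    using transpose_fib(2)[OF A B a] transpose_fib(2)[OF A B b] eq
      F.fib_inj[OF chosen_quotient(1)[OF A] chosen_quotient(1)[OF B] completion_fibD[OF a] completion_fibD[OF b]] by simp
qed (simp_all add: K_Idn K_Comp K_re K_dg K_rc K_cv chosen_quotient transpose_arrow(1) transpose_fib(1) K_le K_faithful)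

lemma K_fib_surj:
  assumes A: "A \<in> Ob T" and B: "B \<in> Ob T" and b: "\<beta> \<in> fib R (FOb K A) (FOb K B)"
  shows "\<exists>\<alpha>\<in>fib T A B. FFib K A B \<alpha> = \<beta>"
proof -
  note qA = chosen_quotient[OF A] and qB = chosen_quotient[OF B]
  obtain \<alpha> where a: "\<alpha> \<in> fib S (fst A) (fst B)" "FFib F (fst A) (fst B) \<alpha> = re R (q A) (q B) \<beta>"
    using F.fib_lift[OF qA(1) qB(1) F.cod.re_closed[OF qA(6) qB(6) b]] by metis
  then show ?thesis using completion_fibI[OF A B a(1) b] by auto
qed

text \<open>
  Projectivity lifts \<open>h \<circ> q A\<close> along \<open>q B\<close> to an arrow between values of \<open>F\<close>, whose preimage under \<open>F\<close>
  represents the required arrow.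
\<close>

lemma K_full:
  assumes P: "\<And>X. X \<in> Ob S \<Longrightarrow> projective R (FOb F X)"
    and A: "A \<in> Ob T" and B: "B \<in> Ob T" and h: "h \<in> Hom R (FOb K A) (FOb K B)"
  shows "\<exists>u\<in>Hom T A B. FAr K u = h"
proof -
  note qA = chosen_quotient[OF A] and qB = chosen_quotient[OF B]
  have "\<exists>k\<in>Hom R (F0 A) (F0 B). Comp R h (q A) = Comp R (q B) k"
    using P[OF qA(1)] q_quotient[OF B] F.cod.Comp_in_Hom[OF qA(6) h]
    unfolding projective_def is_quotient_arrow_def by blast
  then obtain k where k: "k \<in> Hom R (F0 A) (F0 B)" "Comp R h (q A) = Comp R (q B) k" by blast
  obtain f where f: "f \<in> Hom S (fst A) (fst B)" "FAr F f = k"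
    using F.Hom_lift[OF qA(1) qB(1) k(1)] .
  then show ?thesis using transpose_eq_class[OF A B f(1) h] k(2) by (auto simp: qF_def)
qed

text \<open>
  Essential surjectivity: the cover of \<open>X\<close> is a quotient arrow of some \<open>F \<rho>\<close>, as is the chosen one
  at \<open>(P, \<rho>)\<close>, so their codomains are isomorphic.
\<close>

lemma equivalence_if_projective_cover:
  assumes P: "\<And>X. X \<in> Ob S \<Longrightarrow> projective R (FOb F X)"
    and C: "\<And>X. X \<in> Ob R \<Longrightarrow> \<exists>P\<in>Ob S. \<exists>p. is_quotient_arrow R (FOb F P) p X"
  shows "eqrd_equivalence T R K"
proof -
  interpret D: doctrine_transport T R K by (rule transport)
  interpret K: rd_arrow T R K by (rule D.transported_rd_arrow)
  interpret K: ess_surj_arrow T R K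
  proof
    show "fully_faithful T R K"
      unfolding fully_faithful_def bij_betw_def
    proof (intro ballI conjI)
      fix A B assume A: "A \<in> Ob T" and B: "B \<in> Ob T"
      show "inj_on (FAr K) (Hom T A B)" by (rule inj_onI) (rule K_faithful)
      show "FAr K ` Hom T A B = Hom R (FOb K A) (FOb K B)"
        using K_full[OF P A B] transpose_arrow(1) by blast
      show "inj_on (FFib K A B) (fib T A B)" by (rule inj_onI) (rule D.K_inj_fib[OF A B])
      show "FFib K A B ` fib T A B = fib R (FOb K A) (FOb K B)"
        using K_fib_surj[OF A B] transpose_fib(1)[OF A B] by blast
    qed (rule K_le)
    show "extensional R" "has_quotients R" by (rule R_ext, rule R_quot)
    fix X assume "X \<in> Ob R"
    then obtain P p \<rho>' where P: "P \<in> Ob S" and p: "quotient_arrow R (FOb F P) \<rho>' p X"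
      using C unfolding is_quotient_arrow_def by blast
    note D = F.cod.quotient_arrowD[OF p]
    obtain \<rho> where r: "\<rho> \<in> fib S P P" "FFib F P P \<rho> = \<rho>'" using F.fib_lift[OF P P D(6)] .
    have A: "(P, \<rho>) \<in> Ob T" using F.eqrel_iff[OF P r(1)] r(2) D(1) by (simp add: completion_Ob)
    have "quotient_arrow R (FOb F P) \<rho>' (q (P, \<rho>)) (FOb K (P, \<rho>))"
      using q_quotient[OF A] r(2) by simp
    then obtain e e' where "inverse_pair R e e' (FOb K (P, \<rho>)) X"
      using F.cod.quotient_unique[OF _ p] by metis
    then show "\<exists>A\<in>Ob T. \<exists>e e'. inverse_pair R e e' (FOb K A) X" using A by blast
  qed
  show ?thesis by (rule K.equivalence)
qed

end

section \<open>Covers and projectives from an equivalence\<close>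

lemma equivalence_ess_surj:
  assumes "eqrd_equivalence T R K" "X \<in> Ob R"
  shows "\<exists>A\<in>Ob T. \<exists>e e'. inverse_pair R e e' (FOb K A) X"
proof -
  obtain G where G: "eqrd_arrow R T G" "iso_one_arrows R R (rd_comp K G) rd_id"
    using assms(1) unfolding eqrd_equivalence_def by blast
  obtain e e' where e: "two_arrow R R (rd_comp K G) rd_id e" "two_arrow R R rd_id (rd_comp K G) e'"
    "\<forall>X\<in>Ob R. Comp R (e' X) (e X) = Idn R (FOb K (FOb G X)) \<and> Comp R (e X) (e' X) = Idn R X"
    using G(2) unfolding iso_one_arrows_def by (auto simp: rd_comp_def rd_id_def)
  interpret G: rd_arrow R T G using G(1) by (simp add: eqrd_arrow_def)
  have "inverse_pair R (e X) (e' X) (FOb K (FOb G X)) X"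
    using e assms(2) by (simp add: inverse_pair_def two_arrow_def rd_comp_def rd_id_def)
  then show ?thesis using G.FOb_closed[OF assms(2)] by blast
qed

text \<open>
  The pseudo-inverse \<open>G\<close> is faithful because \<open>K \<circ> G\<close> is isomorphic to the identity. Conjugating \<open>G h\<close> by
  the other isomorphism gives an arrow \<open>u\<close> with \<open>G (K u) = G h\<close>.
\<close>

lemma equivalence_full:
  assumes eqv: "eqrd_equivalence T R K" and A: "A \<in> Ob T" and B: "B \<in> Ob T"
    and h: "h \<in> Hom R (FOb K A) (FOb K B)"
  shows "\<exists>u\<in>Hom T A B. FAr K u = h"
proof -
  obtain G where G: "eqrd_arrow T R K" "eqrd_arrow R T G" "iso_one_arrows T T rd_id (rd_comp G K)"
    "iso_one_arrows R R (rd_comp K G) rd_id"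
    using eqv unfolding eqrd_equivalence_def by blast
  interpret K: rd_arrow T R K using G(1) by (simp add: eqrd_arrow_def)
  interpret G: rd_arrow R T G using G(2) by (simp add: eqrd_arrow_def)
  obtain e e' where e: "two_arrow R R (rd_comp K G) rd_id e" "two_arrow R R rd_id (rd_comp K G) e'"
    "\<forall>X\<in>Ob R. Comp R (e' X) (e X) = Idn R (FOb K (FOb G X)) \<and> Comp R (e X) (e' X) = Idn R X"
    using G(4) unfolding iso_one_arrows_def by (auto simp: rd_comp_def rd_id_def)
  obtain t t' where t: "two_arrow T T rd_id (rd_comp G K) t" "two_arrow T T (rd_comp G K) rd_id t'"
    "\<forall>X\<in>Ob T. Comp T (t' X) (t X) = Idn T X \<and> Comp T (t X) (t' X) = Idn T (FOb G (FOb K X))"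
    using G(3) unfolding iso_one_arrows_def by (auto simp: rd_comp_def rd_id_def)
  have pe: "inverse_pair R (e X) (e' X) (FOb K (FOb G X)) X" if "X \<in> Ob R" for X
    using e that by (simp add: inverse_pair_def two_arrow_def rd_comp_def rd_id_def)
  have ne: "Comp R (e Y) (FAr K (FAr G f)) = Comp R f (e X)" if "f \<in> Hom R X Y" for f X Y
    using e that K.cod.Hom_Ob[OF that] by (simp add: two_arrow_def rd_comp_def rd_id_def)
  have pt: "inverse_pair T (t X) (t' X) X (FOb G (FOb K X))" if "X \<in> Ob T" for X
    using t that by (simp add: inverse_pair_def two_arrow_def rd_comp_def rd_id_def)
  have nt: "Comp T (t Y) f = Comp T (FAr G (FAr K f)) (t X)" if "f \<in> Hom T X Y" for f X Y
    using t that K.dom.Hom_Ob[OF that] by (simp add: two_arrow_def rd_comp_def rd_id_def)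
  have G_faithful: "f = f'" if f: "f \<in> Hom R X Y" "f' \<in> Hom R X Y" and eq: "FAr G f = FAr G f'"
    for f f' X Y
  proof -
    have "Comp R f (e X) = Comp R f' (e X)" using ne[OF f(1)] ne[OF f(2)] eq by simp
    then show ?thesis
      using K.cod.cancel_inverse_right[OF pe f(1)] K.cod.cancel_inverse_right[OF pe f(2)]
        K.cod.Hom_Ob[OF f(1)] by metis
  qed
  note tA = K.dom.inverse_pairD[OF pt[OF A]] and tB = K.dom.inverse_pairD[OF pt[OF B]]
  note Gh = G.FAr_closed[OF h]
  note Gt = K.dom.Comp_in_Hom[OF tA(1) Gh]
  define u where "u = Comp T (t' B) (Comp T (FAr G h) (t A))"
  have u: "u \<in> Hom T A B" unfolding u_def by (rule K.dom.Comp_in_Hom[OF Gt tB(2)])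
  have "Comp T (FAr G (FAr K u)) (t A) = Comp T (FAr G h) (t A)"
    using nt[OF u] K.dom.cancel_inverse_left[OF K.dom.inverse_pair_sym[OF pt[OF B]] Gt]
    by (simp add: u_def)
  then have "FAr G (FAr K u) = FAr G h"
    using K.dom.cancel_inverse_right[OF pt[OF A] G.FAr_closed[OF K.FAr_closed[OF u]]]
      K.dom.cancel_inverse_right[OF pt[OF A] Gh] by metis
  then have "FAr K u = h" by (rule G_faithful[OF K.FAr_closed[OF u] h])
  then show ?thesis using u by blast
qed

context transpose
begin

lemma cover_if_equivalence:
  assumes eqv: "eqrd_equivalence T R K" and X: "X \<in> Ob R"
  shows "\<exists>A\<in>Ob T. \<exists>p. quotient_arrow R (F0 A) (FFib F (fst A) (fst A) (snd A)) p X"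
  using equivalence_ess_surj[OF eqv X] F.cod.quotient_Comp_iso q_quotient by metis

text \<open>
  With \<open>t = p \<circ> c\<close> for a cover \<open>c : F B \<rightarrow> X\<close>, the codomain \<open>Y\<close> is isomorphic to the value of \<open>K\<close> at
  \<open>D = (B, \<sigma>)\<close>, where \<open>F \<sigma>\<close> is the kernel of \<open>t\<close>. The arrow \<open>f\<close> then corresponds to an arrow from
  \<open>(P, d)\<close> to \<open>D\<close>, and the image under \<open>F\<close> of a representative, followed by \<open>c\<close>, is the lift.
\<close>

lemma projective_if_equivalence:
  assumes eqv: "eqrd_equivalence T R K" and P: "P \<in> Ob S"
  shows "projective R (FOb F P)"
  unfolding projective_def
proof (intro conjI allI impI ballI)
  show "FOb F P \<in> Ob R" by (rule F.FOb_closed[OF P])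
  fix X Y p f assume "is_quotient_arrow R X p Y" and f: "f \<in> Hom R (FOb F P) Y"
  then obtain \<tau> where p: "quotient_arrow R X \<tau> p Y" by (auto simp: is_quotient_arrow_def)
  note pD = F.cod.quotient_arrowD[OF p]
  obtain C c where C: "C \<in> Ob T"
    and c: "quotient_arrow R (F0 C) (FFib F (fst C) (fst C) (snd C)) c X"
    using cover_if_equivalence[OF eqv pD(4)] by blast
  note cD = F.cod.quotient_arrowD[OF c] and qC = chosen_quotient[OF C]
  define t where "t = Comp R p c"
  have t: "quotient_arrow R (F0 C) (kernel R t) t Y"
    unfolding t_def by (rule F.cod.quotient_Comp_quotient[OF R_quot c p])
  note tD = F.cod.quotient_arrowD[OF t]
  obtain \<sigma> where s: "\<sigma> \<in> fib S (fst C) (fst C)" "FFib F (fst C) (fst C) \<sigma> = kernel R t"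
    using F.fib_lift[OF qC(1) qC(1) tD(6)] .
  define D where "D = (fst C, \<sigma>)"
  have D: "D \<in> Ob T" using F.eqrel_iff[OF qC(1) s(1)] s(2) tD(1) by (simp add: completion_Ob D_def)
  note qD = chosen_quotient[OF D]
  have "quotient_arrow R (F0 C) (kernel R t) (q D) (FOb K D)"
    using q_quotient[OF D] s(2) by (simp add: D_def)
  then obtain w w' where w: "inverse_pair R w w' (FOb K D) Y" "Comp R w (q D) = t"
    using F.cod.quotient_unique[OF _ t] by metis
  note wD = F.cod.inverse_pairD[OF w(1)]
  define A where "A = (P, dg S P)"
  have A: "A \<in> Ob T"
    using F.dom.eqrel_kernel[OF F.dom.Idn_in_Hom[OF P]] P by (simp add: F.dom.kernel_Idn completion_Ob A_def)
  note qA = chosen_quotient[OF A, unfolded A_def fst_conv, folded A_def]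
  have "quotient_arrow R (FOb F P) (dg R (FOb F P)) (q A) (FOb K A)"
    using q_quotient[OF A] F.FFib_dg[OF P] by (simp add: A_def)
  moreover have "le R (FOb F P) (FOb F P) (dg R (FOb F P)) (kernel R (Idn R (FOb F P)))"
    using F.FOb_closed[OF P] by (simp add: F.cod.kernel_Idn F.cod.le_reflI F.cod.dg_closed)
  \<comment> \<open>A quotient arrow of an identity relation is split by \<open>r\<close>, which turns arrows out of \<open>F P\<close> into
    arrows out of \<open>K A\<close>.\<close>
  ultimately obtain r where r: "r \<in> Hom R (FOb K A) (FOb F P)" "Comp R r (q A) = Idn R (FOb F P)"
    using F.cod.quotient_factor F.cod.Idn_in_Hom[OF F.FOb_closed[OF P]] by metis
  note wf = F.cod.Comp_in_Hom[OF f wD(2)]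
  obtain u where u: "u \<in> Hom T A D" "FAr K u = Comp R (Comp R w' f) r"
    using equivalence_full[OF eqv A D F.cod.Comp_in_Hom[OF r(1) wf]] by blast
  define k where "k = FAr F (eq_rep u)"
  have k: "k \<in> Hom R (FOb F P) (F0 C)"
    using F.FAr_closed[OF rep_Hom[OF u(1)]] by (simp add: k_def A_def D_def)
  have "Comp R (q D) k = Comp R (Comp R (Comp R w' f) r) (q A)"
    using transpose_arrow(2)[OF u(1)] u(2) by (simp add: qF_def k_def)
  also have "\<dots> = Comp R w' f"
    using F.cod.Comp_assoc[OF qA(6) r(1) wf] r(2) F.cod.Comp_Idn_right[OF wf] by simp
  finally have "Comp R w (Comp R (q D) k) = f"
    using F.cod.cancel_inverse_left[OF F.cod.inverse_pair_sym[OF w(1)] f] by simp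
  then have "f = Comp R t k"
    using F.cod.Comp_assoc[of k "FOb F P" "F0 C" "q D" "FOb K D" w Y] k qD(6) wD(1) w(2)
    by (simp add: D_def)
  then have "f = Comp R p (Comp R c k)"
    unfolding t_def using F.cod.Comp_assoc[OF k cD(2) pD(2)] by simp
  then show "\<exists>h\<in>Hom R (FOb F P) X. f = Comp R p h"
    using F.cod.Comp_in_Hom[OF k cD(2)] by blast
qed

end

section \<open>Restriction to the projective objects\<close>

lemma Proj_sel [simp]:
  "Ob (Proj R) = {P. projective R P}"
  "Ar (Proj R) = {f \<in> Ar R. projective R (Dom R f) \<and> projective R (Cod R f)}"
  "Dom (Proj R) = Dom R" "Cod (Proj R) = Cod R"
  "Idn (Proj R) = Idn R" "Comp (Proj R) = Comp R" "fib (Proj R) = fib R" "le (Proj R) = le R"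
  "re (Proj R) = re R" "rc (Proj R) = rc R" "cv (Proj R) = cv R" "dg (Proj R) = dg R"
  "Hom (Proj R) X Y = {f \<in> Hom R X Y. projective R X \<and> projective R Y}"
  by (auto simp: Proj_def Hom_def)

text \<open>
  Transport along the inclusion, whose underlying data are identities.
\<close>

lemma relational_doctrine_Proj:
  assumes "relational_doctrine R"
  shows "relational_doctrine (Proj R)"
proof -
  interpret R: relational_doctrine R by fact
  have P: "P \<in> Ob R" if "projective R P" for P using that by (simp add: projective_def)
  interpret doctrine_transport "Proj R" R rd_id
    by unfold_locales
      (auto simp: rd_id_def P R.Idn_in_Hom R.dg_closed R.rc_closed R.cv_closed
        intro: R.Comp_in_Hom R.re_closed)
  show ?thesis by (rule transported_doctrine)
qed

lemma factors_through_Proj_iff: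
  assumes F: "rd_arrow S R F"
  shows "factors_through_Proj S R F \<longleftrightarrow> (\<forall>X\<in>Ob S. projective R (FOb F X))"
proof
  assume "factors_through_Proj S R F"
  then obtain G where G: "rd_arrow S (Proj R) G" "rd_eq S F (rd_comp rd_id G)"
    unfolding factors_through_Proj_def by blast
  then show "\<forall>X\<in>Ob S. projective R (FOb F X)"
    using rd_arrow.FOb_closed[OF G(1)] by (simp add: rd_eq_def rd_comp_def rd_id_def)
next
  assume P: "\<forall>X\<in>Ob S. projective R (FOb F X)"
  interpret F: rd_arrow S R F by fact
  have "rd_arrow S (Proj R) F"
  proof (intro rd_arrow.intro F.dom.relational_doctrine_axioms
      relational_doctrine_Proj F.cod.relational_doctrine_axioms, unfold_locales)
    fix f X Y assume f: "f \<in> Hom S X Y"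
    show "FAr F f \<in> Hom (Proj R) (FOb F X) (FOb F Y)"
      using F.FAr_closed[OF f] F.dom.Hom_Ob[OF f] P by simp
  qed (use P F.FFib_mono in \<open>simp_all add: F.FAr_Idn F.FAr_Comp F.FFib_closed F.FFib_natural F.FFib_dg
      F.FFib_rc F.FFib_cv\<close>)
  moreover have "rd_eq S F (rd_comp rd_id F)" by (simp add: rd_eq_def rd_comp_def rd_id_def)
  ultimately show "factors_through_Proj S R F" unfolding factors_through_Proj_def by blast
qed

section \<open>The characterization\<close>

theorem theorem6p7:
  fixes R :: "('p, 'b, 's) doctrine"
    and S :: "('o, 'a, 'r) doctrine"
    and F :: "('o, 'a, 'r, 'p, 'b, 's) rd_map"
    and q :: "'o \<times> 'r \<Rightarrow> 'b"
  assumes "relational_doctrine R" and "extensional R" and "has_quotients R"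
    and "relational_doctrine S"
    and "rd_arrow S R F" and "fully_faithful S R F"
    and "quotient_choice S R F q"
  shows "eqrd_equivalence (eq_completion S) R (eq_transpose R F q) \<longleftrightarrow>
    (factors_through_Proj S R F \<and>
     (\<forall>X\<in>Ob R. \<exists>P\<in>Ob S. \<exists>p. is_quotient_arrow R (FOb F P) p X))"
proof -
  interpret transpose S R F q
    using assms by (intro transpose.intro ff_arrow.intro ff_arrow_axioms.intro transpose_axioms.intro)
  show ?thesis
    unfolding factors_through_Proj_iff[OF assms(5)]
  proof
    assume eqv: "eqrd_equivalence T R K"
    have "\<exists>P\<in>Ob S. \<exists>p. is_quotient_arrow R (FOb F P) p X" if X: "X \<in> Ob R" for X
      using cover_if_equivalence[OF eqv X] chosen_quotient(1) unfolding is_quotient_arrow_def by blast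
    then show "(\<forall>X\<in>Ob S. projective R (FOb F X)) \<and>
        (\<forall>X\<in>Ob R. \<exists>P\<in>Ob S. \<exists>p. is_quotient_arrow R (FOb F P) p X)"
      using projective_if_equivalence[OF eqv] by blast
  next
    assume "(\<forall>X\<in>Ob S. projective R (FOb F X)) \<and>
        (\<forall>X\<in>Ob R. \<exists>P\<in>Ob S. \<exists>p. is_quotient_arrow R (FOb F P) p X)"
    then show "eqrd_equivalence T R K" by (intro equivalence_if_projective_cover) auto
  qed
qed

end
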